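(* Let $w\in A_\infty^*$ be a strong Muckenhoupt weight on $\mathbb R^n$. There exists a constant $c_{w,n}>0$ depending only on $w$ and the dimension $n$ such that $$\mathsf C_{\mathsf S}^{w}(\alpha)-1\lesssim_{w,n}(1-\alpha)^{c_{w,n}}\quad\text{as }\alpha\to1^-;$$ that is, there exist a constant $C>0$ and $\alpha_0\in(0,1)$, depending only on $w$ and $n$, such that $\mathsf C_{\mathsf S}^{w}(\alpha)-1\le C(1-\alpha)^{c_{w,n}}$ for all $\alpha\in(\alpha_0,1)$.
   Context: A weight on $\mathbb R^n$ is a non-negative locally integrable function; $w(E)=\int_E w(x)\,dx$. The strong maximal operator with respect to $w$ is $\mathsf M_{\mathrm S}^wf(x)=\sup_{R\ni x}\frac1{w(R)}\int_R|f(y)|w(y)\,dy$, $x\in\mathbb R^n$, with the supremum over all rectangular parallelepipeds $R\subseteq\mathbb R^n$ with sides parallel to the coordinate axes. For $\alpha\in(0,1)$, $$\mathsf C_{\mathsf S}^w(\alpha)=\sup_{E\subset\mathbb R^n,\ 0<w(E)<+\infty}\frac1{w(E)}\,w(\{x\in\mathbb R^n:\ \mathsf M_{\mathrm S}^w(\mathbf 1_E)(x)>\alpha\}),$$ the supremum being over measurable sets $E$. For a weight $v$ on $\mathbb R$, the Fujii–Wilson constant is $[v]_{A_\infty}=\sup_I\frac1{v(I)}\int_I\mathsf M_1(v\mathbf 1_I)$, the supremum over bounded intervals $I\subset\mathbb R$, where $\mathsf M_1f(x)=\sup_{I\ni x}\frac1{|I|}\int_I|f|$. For a weight $w$ on $\mathbb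 R^n$, $1\le j\le n$ and $\bar x^j=(x_1,\dots,x_{j-1},x_{j+1},\dots,x_n)\in\mathbb R^{n-1}$, let $w_{\bar x^j}(t)=w(x_1,\dots,x_{j-1},t,x_{j+1},\dots,x_n)$, $t\in\mathbb R$. Define $[w]_{A_\infty^*}=\sup_{1\le j\le n}\operatorname{ess\,sup}_{\bar x^j\in\mathbb R^{n-1}}[w_{\bar x^j}]_{A_\infty}$. The class $A_\infty^*$ of strong Muckenhoupt weights consists of the weights $w$ with $[w]_{A_\infty^*}<+\infty$. *)

theory Defs
  imports "HOL-Analysis.Analysis"
begin

text \<open>
  All averages, measures and suprema below are taken in \<^typ>\<open>ennreal\<close>, where \<open>0 / 0 = 0\<close>:
  rectangles and intervals of zero weight contribute nothing to a supremum of averages.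
  Rectangles and intervals are closed, bounded and non-degenerate; since their boundaries are
  Lebesgue null sets, admitting open or half-open ones would not change any of the suprema.
\<close>

definition weight :: "('a::euclidean_space \<Rightarrow> real) \<Rightarrow> bool" where
  "weight w \<longleftrightarrow> (\<forall>x. 0 \<le> w x) \<and> (\<forall>K. compact K \<longrightarrow> w absolutely_integrable_on K)"

definition wmeasure :: "('a::euclidean_space \<Rightarrow> real) \<Rightarrow> 'a set \<Rightarrow> ennreal" where
  "wmeasure w E = (\<integral>\<^sup>+x\<in>E. ennreal (w x) \<partial>lebesgue)"

definition strong_maximal :: "(real^'n \<Rightarrow> real) \<Rightarrow> (real^'n \<Rightarrow> real) \<Rightarrow> real^'n \<Rightarrow> ennreal" where
  "strong_maximal w f x =
     (SUP (a, b) \<in> {(a, b). box a b \<noteq> {} \<and> x \<in> cbox a b}.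
        (\<integral>\<^sup>+y\<in>cbox a b. ennreal (\<bar>f y\<bar> * w y) \<partial>lebesgue) / wmeasure w (cbox a b))"

definition tauberian_const :: "(real^'n \<Rightarrow> real) \<Rightarrow> real \<Rightarrow> ennreal" where
  "tauberian_const w \<alpha> =
     (SUP E \<in> {E \<in> sets lebesgue. 0 < wmeasure w E \<and> wmeasure w E < \<infinity>}.
        wmeasure w {x. ennreal \<alpha> < strong_maximal w (indicator E) x} / wmeasure w E)"

definition maximal1 :: "(real \<Rightarrow> real) \<Rightarrow> real \<Rightarrow> ennreal" where
  "maximal1 f x =
     (SUP (a, b) \<in> {(a, b). a < b \<and> x \<in> {a..b}}.
        (\<integral>\<^sup>+y\<in>{a..b}. ennreal \<bar>f y\<bar> \<partial>lebesgue) / emeasure lebesgue {a..b})"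

definition fujii_wilson_const :: "(real \<Rightarrow> real) \<Rightarrow> ennreal" where
  "fujii_wilson_const v =
     (SUP (a, b) \<in> {(a, b). a < b}.
        (\<integral>\<^sup>+x\<in>{a..b}. maximal1 (\<lambda>y. v y * indicator {a..b} y) x \<partial>lebesgue)
          / wmeasure v {a..b})"

text \<open>
  The essential supremum in \<open>HOL-Probability\<close> is infinite, by convention, for functions that are
  not measurable. As a slice constant of a merely Lebesgue measurable weight need not be Borel
  measurable, we use the almost-everywhere form, which makes no such requirement.
\<close>

definition ess_sup :: "'a measure \<Rightarrow> ('a \<Rightarrow> ennreal) \<Rightarrow> ennreal" where
  "ess_sup M f = Inf {c. AE x in M. f x \<le> c}"

text \<open>
  A point of the \<open>(n - 1)\<close>-dimensional space obtained by deleting the \<open>j\<close>-th coordinate is a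
  function \<open>y\<close> on the index set \<^term>\<open>UNIV - {j}\<close>, and that space carries the product of copies
  of Lebesgue measure (on Borel sets; completing it would give the same null sets up to
  inclusion, hence the same meaning of almost everywhere).
\<close>

definition slice :: "(real^'n \<Rightarrow> real) \<Rightarrow> 'n \<Rightarrow> ('n \<Rightarrow> real) \<Rightarrow> real \<Rightarrow> real" where
  "slice w j y t = w (\<chi> i. if i = j then t else y i)"

definition strong_A_infinity_const :: "(real^'n \<Rightarrow> real) \<Rightarrow> ennreal" where
  "strong_A_infinity_const w =
     (SUP j. ess_sup (Pi\<^sub>M (UNIV - {j}) (\<lambda>_. lborel)) (\<lambda>y. fujii_wilson_const (slice w j y)))"

definition strong_muckenhoupt :: "(real^'n \<Rightarrow> real) \<Rightarrow> bool" where
  "strong_muckenhoupt w \<longleftrightarrow> weight w \<and> strong_A_infinity_const w < \<infinity>"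

end

theory Submission imports Defs begin

text \<open>
  The set where the maximal function of the indicator of \<open>E\<close> exceeds \<open>\<alpha>\<close> is a union of rectangles \<open>R\<close>
  with \<open>w(R - E) < (1 - \<alpha>) w(R)\<close>. The difficulty is that such rectangles may overlap wildly in
  dimension two and higher, so that no simple covering argument applies to them. On a line there is
  no such problem: every finite family of intervals has a subfamily with the same union and
  overlap at most two. The proof therefore reduces rectangles to lines, and pays for the reduction
  with the strong Muckenhoupt condition.

  In dimension one, a finite Fujii--Wilson constant forces \<open>v(S) \<le> v(I)/2\<close> whenever \<open>S\<close> is a small
  part of an interval \<open>I\<close> (\<open>fujii_wilson_halving\<close>). Repeating a Calderon--Zygmund decomposition
  turns this into power laws in both directions (\<open>halving_power_law\<close>, \<open>halving_reverse_power_law\<close>):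
  with \<open>|S|/|I| = t\<close> one has \<open>v(S)/v(I) \<lesssim> t\<^sup>\<delta>\<close>, and with \<open>v(S)/v(I) = t\<close> one has \<open>|S|/|I| \<lesssim> t\<^sup>\<beta>\<close>.
  Both come from the same iteration lemma (\<open>power_decay\<close>), applied to the pair (Lebesgue, \<open>v\<close>) and to
  the pair (\<open>v\<close>, Lebesgue).

  For a set \<open>F\<close> let its halo in direction \<open>j\<close> consist of the points lying on an interval in direction
  \<open>j\<close> of which \<open>F\<close> misses less than a fraction \<open>e\<close>, measured by length. By the first power law such an
  interval is also filled by \<open>F\<close> up to a fraction of order \<open>e\<^sup>\<delta>\<close> in weighted measure, and then the
  two-fold covering shows that the halo has \<open>w\<close>-measure at most \<open>1 + O(e\<^sup>\<delta>)\<close> times that of \<open>F\<close>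
  (\<open>halo_measure_le\<close>).

  Conversely, a rectangle with \<open>w(R - E) < s\<^sup>n w(R)\<close> lies in the \<open>n\<close>-fold iterated halo of \<open>E\<close> as soon
  as \<open>e\<close> exceeds a constant times \<open>s\<^sup>\<beta>\<close> (\<open>mem_iter_haloI\<close>). This is Fubini and Chebyshev, one coordinate
  at a time: the integral of \<open>w\<close> over the remaining coordinates, as a function of one coordinate \<open>t\<close>,
  inherits the halving property, because that property is linear in the weight; so the values of
  \<open>t\<close> whose section is bad form a set that is small in weighted measure, hence, by the second
  power law, small in length.

  With \<open>s\<^sup>n = 1 - \<alpha>\<close> and \<open>e\<close> of order \<open>s\<^sup>\<beta>\<close> the two estimates combine to
  \<open>1 + O(e\<^sup>\<delta>) = 1 + O((1 - \<alpha>) powr (\<beta> * \<delta> / n))\<close>.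
\<close>

section \<open>Interval coverings and components on the line\<close>

text \<open>
  A subfamily of least cardinality with the same union will do: among three intervals through a
  common point, the one reaching furthest to the left and the one reaching furthest to the right
  already cover the third.
\<close>
lemma finite_intervals_overlap_le_2:
  fixes F :: "real set set"
  assumes fin: "finite F" and int: "\<And>J. J \<in> F \<Longrightarrow> \<exists>c d. J = {c<..<d}"
  obtains G where "G \<subseteq> F" "\<Union>G = \<Union>F" "\<And>x. card {J \<in> G. x \<in> J} \<le> 2"
proof -
  obtain G where G: "G \<subseteq> F" "\<Union>G = \<Union>F"
    and min: "\<And>G'. G' \<subseteq> F \<Longrightarrow> \<Union>G' = \<Union>F \<Longrightarrow> card G \<le> card G'"
    using ex_has_least_nat[of "\<lambda>G. G \<subseteq> F \<and> \<Union>G = \<Union>F" F card] by auto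
  have finG: "finite G" using G fin finite_subset by blast
  obtain c d where cd: "\<And>J. J \<in> F \<Longrightarrow> J = {c J<..<d J}" using int by metis
  have "card {J \<in> G. x \<in> J} \<le> 2" for x
  proof (rule ccontr)
    assume "\<not> card {J \<in> G. x \<in> J} \<le> 2"
    then have "3 \<le> card {J \<in> G. x \<in> J}" by simp
    then obtain S where S: "S \<subseteq> {J \<in> G. x \<in> J}" "card S = 3" "finite S"
      by (rule obtain_subset_with_card_n)
    have "S \<noteq> {}" using S(2) by auto
    then obtain L where L: "L \<in> S" "\<And>J. J \<in> S \<Longrightarrow> c L \<le> c J"
      using arg_min_if_finite[of S c] S(3) by (metis arg_min_least)
    obtain R where R: "R \<in> S" "\<And>J. J \<in> S \<Longrightarrow> d J \<le> d R"
      using arg_min_if_finite[of S "\<lambda>J. - d J"] S(3) \<open>S \<noteq> {}\<close> 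
      by (metis arg_min_least neg_le_iff_le)
    have "card {L, R} < card S" using S(2) by (simp add: card_insert_if)
    then have "\<not> S \<subseteq> {L, R}" by (metis card_mono finite.emptyI finite_insert leD)
    then obtain K where K: "K \<in> S" "K \<noteq> L" "K \<noteq> R" by blast
    have SG: "J \<in> G" "x \<in> J" "J = {c J<..<d J}" if "J \<in> S" for J
      using that S(1) G(1) cd by blast+
    have "K \<subseteq> L \<union> R"
    proof
      fix y assume "y \<in> K"
      have "c K < y" "y < d K" using SG(3)[OF K(1)] \<open>y \<in> K\<close> by auto
      moreover have "c R < x" "x < d L" using SG[OF L(1)] SG[OF R(1)] by auto
      moreover have "c L \<le> c K" "d K \<le> d R" using L R K by auto
      ultimately have "y \<in> {c L<..<d L} \<or> y \<in> {c R<..<d R}" by auto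
      then show "y \<in> L \<union> R" using SG(3)[OF L(1)] SG(3)[OF R(1)] by auto
    qed
    moreover have "L \<in> G - {K}" "R \<in> G - {K}" using SG(1)[OF L(1)] SG(1)[OF R(1)] K by auto
    ultimately have "\<Union>G \<subseteq> \<Union>(G - {K})" by blast
    then have "\<Union>(G - {K}) = \<Union>G" by (meson Diff_subset Union_mono subset_antisym)
    then have "\<Union>(G - {K}) = \<Union>F" using G(2) by simp
    then have "card G \<le> card (G - {K})" using G(1) by (intro min) auto
    moreover have "card (G - {K}) < card G" using finG SG(1)[OF K(1)] by (rule card_Diff1_less)
    ultimately show False by simp
  qed
  then show thesis using that G by blast
qed

lemma emeasure_Union_intervals_finite:
  fixes F :: "real set set"
  assumes sM: "sets M = sets borel" and sN: "sets N = sets borel"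
    and fin: "finite F" and int: "\<And>J. J \<in> F \<Longrightarrow> \<exists>c d. J = {c<..<d}"
    and le: "\<And>J. J \<in> F \<Longrightarrow> emeasure M J \<le> r * emeasure N J"
  shows "emeasure M (\<Union>F) \<le> 2 * r * emeasure N (\<Union>F)"
proof -
  obtain G where G: "G \<subseteq> F" "\<Union>G = \<Union>F" "\<And>x. card {J \<in> G. x \<in> J} \<le> 2"
    using finite_intervals_overlap_le_2[OF fin int] by blast
  have finG: "finite G" using G fin finite_subset by blast
  have b: "J \<in> sets borel" if "J \<in> G" for J using that int G(1) by (metis borel_open open_greaterThanLessThan subsetD)
  have bN: "J \<in> sets N" if "J \<in> G" for J unfolding sN using that by (rule b)
  have UN: "\<Union>G \<in> sets N" using bN finG by (metis sets.finite_Union subsetI)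
  have "emeasure M (\<Union>F) \<le> (\<Sum>J\<in>G. emeasure M J)"
  proof -
    have "(\<lambda>J. J) ` G \<subseteq> sets M" using b by (auto simp: sM)
    from emeasure_subadditive_finite[OF finG this] show ?thesis by (simp add: G(2))
  qed
  also have "\<dots> \<le> (\<Sum>J\<in>G. r * emeasure N J)" using le G(1) by (intro sum_mono) auto
  also have "\<dots> = r * (\<integral>\<^sup>+x. (\<Sum>J\<in>G. indicator J x) \<partial>N)"
  proof -
    have "(\<integral>\<^sup>+x. (\<Sum>J\<in>G. indicator J x) \<partial>N) = (\<Sum>J\<in>G. \<integral>\<^sup>+x. indicator J x \<partial>N)"
      using bN by (intro nn_integral_sum) simp
    also have "\<dots> = (\<Sum>J\<in>G. emeasure N J)" using bN by (intro sum.cong) simp_all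
    finally show ?thesis by (simp only: sum_distrib_left)
  qed
  also have "\<dots> \<le> r * (\<integral>\<^sup>+x. 2 * indicator (\<Union>G) x \<partial>N)"
  proof (intro mult_left_mono nn_integral_mono)
    fix x
    have "(\<Sum>J\<in>G. indicator J x) = (of_nat (card {J \<in> G. x \<in> J}) :: ennreal)"
      using finG by (simp add: indicator_def sum.If_cases Int_def)
    also have "\<dots> \<le> 2 * indicator (\<Union>G) x"
    proof (cases "x \<in> \<Union>G")
      case True
      then show ?thesis using G(3)[of x] by (metis (no_types, lifting) indicator_simps(1) mult.right_neutral of_nat_le_iff of_nat_numeral)
    next
      case False
      then have "{J \<in> G. x \<in> J} = {}" by auto
      then show ?thesis by (simp only: card.empty) simp
    qed
    finally show "(\<Sum>J\<in>G. indicator J x) \<le> (2 * indicator (\<Union>G) x :: ennreal)" .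
  qed simp
  also have "\<dots> = r * (2 * emeasure N (\<Union>G))" using UN by (simp add: nn_integral_cmult)
  finally show ?thesis unfolding G(2) by (simp only: mult_ac)
qed

text \<open>
  The covering estimate behind both uses of maximal sets: an inequality between two measures on
  each interval of an arbitrary family passes to the union, at the cost of the overlap factor two.
\<close>
lemma emeasure_Union_intervals_le:
  fixes F :: "real set set"
  assumes sM: "sets M = sets borel" and sN: "sets N = sets borel"
    and int: "\<And>J. J \<in> F \<Longrightarrow> \<exists>c d. J = {c<..<d}"
    and le: "\<And>J. J \<in> F \<Longrightarrow> emeasure M J \<le> r * emeasure N J"
  shows "emeasure M (\<Union>F) \<le> 2 * r * emeasure N (\<Union>F)"
proof -
  have op: "open J" if "J \<in> F" for J using int[OF that] by auto
  obtain F' where F': "F' \<subseteq> F" "countable F'" "\<Union>F' = \<Union>F" using Lindelof[of F] op by metis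
  show ?thesis
  proof (cases "F' = {}")
    case True
    then have "\<Union>F = {}" using F'(3) by simp
    then show ?thesis by (simp only: emeasure_empty) simp
  next
    case False
    let ?A = "\<lambda>n. \<Union>(from_nat_into F' ` {..n})"
    have sub: "from_nat_into F' i \<in> F" for i using from_nat_into[OF False] F'(1) by blast
    have U: "(\<Union>n. ?A n) = \<Union>F" 
    proof -
      have "(\<Union>n. ?A n) = \<Union>(range (from_nat_into F'))" by auto
      then show ?thesis using range_from_nat_into[OF False F'(2)] F'(3) by simp
    qed
    have oA: "open (?A n)" for n using op[OF sub] by (intro open_Union) blast
    have m: "range ?A \<subseteq> sets M" using borel_open[OF oA] by (simp only: sM image_subset_iff) simp
    have oU: "open (\<Union>F)" using op by (intro open_Union) blast
    have "incseq ?A" unfolding incseq_def by (intro allI impI Union_mono image_mono) simp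
    then have "emeasure M (\<Union>F) = (SUP n. emeasure M (?A n))"
      using SUP_emeasure_incseq[OF m] U by simp
    also have "\<dots> \<le> 2 * r * emeasure N (\<Union>F)"
    proof (rule SUP_least)
      fix n
      have "emeasure M (?A n) \<le> 2 * r * emeasure N (?A n)"
        using emeasure_Union_intervals_finite[OF sM sN, of "from_nat_into F' ` {..n}" r] int[OF sub] le[OF sub] by (simp only: finite_imageI finite_atMost image_iff) blast
      also have "\<dots> \<le> 2 * r * emeasure N (\<Union>F)"
      proof (intro mult_left_mono emeasure_mono)
        show "?A n \<subseteq> \<Union>F" using sub by blast
        show "\<Union>F \<in> sets N" using oU by (simp only: sN borel_open)
      qed simp
      finally show "emeasure M (?A n) \<le> 2 * r * emeasure N (\<Union>F)" .
    qed
    finally show ?thesis .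
  qed
qed

text \<open>
  Finite measures without atoms: the mass of an interval then depends continuously on its
  endpoints, and enclosing open sets approximate the mass of every Borel set.
\<close>
definition diffuse :: "real measure \<Rightarrow> bool" where
  "diffuse M \<longleftrightarrow> sets M = sets borel \<and> finite_measure M \<and> (\<forall>x. emeasure M {x} = 0)"

lemma open_component_interval:
  fixes U :: "real set"
  assumes "open U" "J \<in> components U" "U \<subseteq> {a<..<b}"
  obtains c d where "a \<le> c" "c < d" "d \<le> b" "J = {c<..<d}"
proof -
  have J: "open J" "connected J" "J \<noteq> {}" "J \<subseteq> {a<..<b}"
    using open_components[OF assms(1,2)] in_components_connected[OF assms(2)] in_components_nonempty[OF assms(2)]
      in_components_subset[OF assms(2)] assms(3) by auto
  have bd: "bdd_below J" "bdd_above J" using bdd_below_mono[OF _ J(4)] bdd_above_mono[OF _ J(4)] by auto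
  let ?c = "Inf J" let ?d = "Sup J"
  have lt: "?c < x" "x < ?d" if xJ: "x \<in> J" for x
  proof -
    obtain e where e: "e > 0" "ball x e \<subseteq> J" using J(1) xJ openE by blast
    have "x - e/2 \<in> ball x e" "x + e/2 \<in> ball x e" using e(1) by (simp_all add: dist_real_def)
    then have "x - e/2 \<in> J" "x + e/2 \<in> J" using e(2) by blast+
    then have "?c \<le> x - e/2" "x + e/2 \<le> ?d" using bd by (auto intro: cInf_lower cSup_upper)
    then show "?c < x" "x < ?d" using e by auto
  qed
  have "J = {?c<..<?d}"
  proof
    show "J \<subseteq> {?c<..<?d}" using lt by auto
    show "{?c<..<?d} \<subseteq> J"
    proof
      fix y assume y: "y \<in> {?c<..<?d}"
      obtain u where u: "u \<in> J" "u < y" using y cInf_lessD[OF J(3)] by auto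
      obtain v where v: "v \<in> J" "y < v" using y less_cSupD[OF J(3)] by auto
      show "y \<in> J" using connected_contains_Icc[OF J(2) u(1) v(1)] u v by auto
    qed
  qed
  moreover have "?c < ?d" using J(3) lt by (meson ex_in_conv less_trans)
  moreover have "a \<le> ?c" using J by (intro cInf_greatest) auto
  moreover have "?d \<le> b" using J by (intro cSup_least) auto
  ultimately show thesis using that by blast
qed

lemma countable_components_open:
  fixes U :: "real set"
  assumes "open U" shows "countable (components U)"
proof (rule countable_disjoint_open_subsets)
  show "\<And>S. S \<in> components U \<Longrightarrow> open S" using assms open_components by blast
  show "disjoint (components U)" using pairwise_disjoint_components by (simp add: pairwise_def disjnt_def)
qed

lemma emeasure_le_if_on_components:
  fixes U :: "real set"
  assumes U: "open U" and sM: "sets M = sets borel" and sN: "sets N = sets borel"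
    and le: "\<And>J. J \<in> components U \<Longrightarrow> emeasure M J \<le> r * emeasure N J"
  shows "emeasure M U \<le> r * emeasure N U"
proof -
  have o: "open J" if "J \<in> components U" for J using U that open_components by blast
  have eq: "emeasure K U = (\<integral>\<^sup>+J. emeasure K J \<partial>count_space (components U))" if "sets K = sets borel" for K
  proof -
    have "emeasure K (\<Union>J\<in>components U. J) = (\<integral>\<^sup>+J. emeasure K J \<partial>count_space (components U))"
      using that o countable_components_open[OF U] pairwise_disjoint_components[of U]
      by (intro emeasure_UN_countable) (auto simp: disjoint_family_on_def pairwise_def)
    then show ?thesis by simp
  qed
  have "emeasure M U \<le> (\<integral>\<^sup>+J. r * emeasure N J \<partial>count_space (components U))"
    unfolding eq[OF sM] using le by (intro nn_integral_mono) auto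
  also have "\<dots> = r * emeasure N U" unfolding eq[OF sN] by (intro nn_integral_cmult) auto
  finally show ?thesis .
qed

section \<open>Decay by repeated Calderon--Zygmund decomposition\<close>

text \<open>
  The union of these intervals plays the role of a superlevel set of the maximal function of \<open>M\<close> with
  respect to \<open>N\<close>. The inequality is not strict, so that intervals on which both measures vanish belong to
  the family.
\<close>
definition dense_intervals :: "ennreal \<Rightarrow> real measure \<Rightarrow> real measure \<Rightarrow> real \<Rightarrow> real \<Rightarrow> real set set" where
  "dense_intervals r N M a b =
     {{c<..<d} |c d. a \<le> c \<and> c < d \<and> d \<le> b \<and> r * emeasure N {c<..<d} \<le> emeasure M {c<..<d}}"

lemma dense_intervalsE:
  assumes "J \<in> dense_intervals r N M a b"
  obtains c d where "a \<le> c" "c < d" "d \<le> b" "J = {c<..<d}" "r * emeasure N J \<le> emeasure M J"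
  using assms unfolding dense_intervals_def by blast

lemma open_Union_dense_intervals: "open (\<Union>(dense_intervals r N M a b))"
  by (intro open_Union) (auto elim: dense_intervalsE)

lemma Union_dense_intervals_subset: "\<Union>(dense_intervals r N M a b) \<subseteq> {a<..<b}"
  by (fastforce elim: dense_intervalsE)

lemma diffuse_tendsto_right:
  assumes "diffuse N" "c < d"
  shows "(\<lambda>n. emeasure N {c<..<d + inverse (Suc n)}) \<longlonglongrightarrow> emeasure N {c<..<d}"
proof -
  interpret finite_measure N using assms(1) by (simp add: diffuse_def)
  have sN: "sets N = sets borel" and z: "emeasure N {d} = 0" using assms(1) by (simp_all add: diffuse_def)
  let ?A = "\<lambda>n. {c<..<d + inverse (Suc n)}"
  have "decseq ?A"
    unfolding decseq_def
  proof (intro allI impI)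
    fix m n :: nat assume "m \<le> n"
    then have "inverse (real (Suc n)) \<le> inverse (real (Suc m))" by simp
    then show "?A n \<subseteq> ?A m" by (intro greaterThanLessThan_subseteq_greaterThanLessThan[THEN iffD2]) simp
  qed
  then have lim: "(\<lambda>n. emeasure N (?A n)) \<longlonglongrightarrow> emeasure N (\<Inter>n. ?A n)"
    by (intro Lim_emeasure_decseq) (auto simp: sN emeasure_eq_measure)
  have I: "(\<Inter>n. ?A n) = {c<..<d} \<union> {d}"
  proof (intro set_eqI iffI)
    fix x assume x: "x \<in> (\<Inter>n. ?A n)"
    have "x \<le> d"
    proof (rule ccontr)
      assume "\<not> x \<le> d"
      then obtain n where "inverse (real (Suc n)) < x - d" using reals_Archimedean[of "x - d"] by auto
      moreover have "x < d + inverse (real (Suc n))" using INT_D[OF x UNIV_I, of n] by simp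
      ultimately show False by simp
    qed
    then show "x \<in> {c<..<d} \<union> {d}" using x by auto
  next
    fix x assume "x \<in> {c<..<d} \<union> {d}"
    then have "c < x" "x \<le> d" using assms(2) by auto
    moreover have "d < d + inverse (real (Suc n))" for n by simp
    ultimately show "x \<in> (\<Inter>n. ?A n)" by (intro INT_I) (metis greaterThanLessThan_iff le_less_trans)
  qed
  have "{d} \<in> null_sets N" using z sN by (auto simp: null_sets_def)
  then have "emeasure N (\<Inter>n. ?A n) = emeasure N {c<..<d}"
    unfolding I by (intro emeasure_Un_null_set) (auto simp: sN)
  then show ?thesis using lim by simp
qed

lemma diffuse_tendsto_left:
  assumes "diffuse N" "c < d"
  shows "(\<lambda>n. emeasure N {c - inverse (Suc n)<..<d}) \<longlonglongrightarrow> emeasure N {c<..<d}"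
proof -
  interpret finite_measure N using assms(1) by (simp add: diffuse_def)
  have sN: "sets N = sets borel" and z: "emeasure N {c} = 0" using assms(1) by (simp_all add: diffuse_def)
  let ?A = "\<lambda>n. {c - inverse (Suc n)<..<d}"
  have "decseq ?A"
    unfolding decseq_def
  proof (intro allI impI)
    fix m n :: nat assume "m \<le> n"
    then have "inverse (real (Suc n)) \<le> inverse (real (Suc m))" by simp
    then show "?A n \<subseteq> ?A m" by (intro greaterThanLessThan_subseteq_greaterThanLessThan[THEN iffD2]) simp
  qed
  then have lim: "(\<lambda>n. emeasure N (?A n)) \<longlonglongrightarrow> emeasure N (\<Inter>n. ?A n)"
    by (intro Lim_emeasure_decseq) (auto simp: sN emeasure_eq_measure)
  have I: "(\<Inter>n. ?A n) = {c<..<d} \<union> {c}"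
  proof (intro set_eqI iffI)
    fix x assume x: "x \<in> (\<Inter>n. ?A n)"
    have "c \<le> x"
    proof (rule ccontr)
      assume "\<not> c \<le> x"
      then obtain n where "inverse (real (Suc n)) < c - x" using reals_Archimedean[of "c - x"] by auto
      moreover have "c - inverse (real (Suc n)) < x" using INT_D[OF x UNIV_I, of n] by simp
      ultimately show False by simp
    qed
    then show "x \<in> {c<..<d} \<union> {c}" using x by auto
  next
    fix x assume "x \<in> {c<..<d} \<union> {c}"
    then have "c \<le> x" "x < d" using assms(2) by auto
    moreover have "c - inverse (real (Suc n)) < c" for n by simp
    ultimately show "x \<in> (\<Inter>n. ?A n)" by (intro INT_I) (metis greaterThanLessThan_iff less_le_trans)
  qed
  have "{c} \<in> null_sets N" using z sN by (auto simp: null_sets_def)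
  then have "emeasure N (\<Inter>n. ?A n) = emeasure N {c<..<d}"
    unfolding I by (intro emeasure_Un_null_set) (auto simp: sN)
  then show ?thesis using lim by simp
qed

text \<open>
  The upper half of the Calderon--Zygmund decomposition. If a component had density above \<open>r\<close>, then by
  continuity a slightly longer interval would still have density at least \<open>r\<close>, hence lie in the union,
  which contradicts the maximality of a component; if no longer interval is available, the component
  is the whole interval, where the bound is assumed.
\<close>
lemma component_dense_intervals_le:
  assumes M: "diffuse M" and N: "diffuse N" and r: "r < \<infinity>"
    and I: "emeasure M {a<..<b} \<le> r * emeasure N {a<..<b}"
    and J: "J \<in> components (\<Union>(dense_intervals r N M a b))"
  shows "emeasure M J \<le> r * emeasure N J"
proof (rule ccontr)
  assume gt: "\<not> emeasure M J \<le> r * emeasure N J"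
  let ?U = "\<Union>(dense_intervals r N M a b)"
  have sM: "sets M = sets borel" using M by (simp add: diffuse_def)
  obtain c d where cd: "a \<le> c" "c < d" "d \<le> b" "J = {c<..<d}"
    using open_component_interval[OF open_Union_dense_intervals J Union_dense_intervals_subset] by blast
  have max: "{c'<..<d'} \<subseteq> {c<..<d}"
    if "a \<le> c'" "c' \<le> c" "d \<le> d'" "d' \<le> b" "r * emeasure N {c'<..<d'} < emeasure M J" for c' d'
  proof -
    have "emeasure M J \<le> emeasure M {c'<..<d'}"
      unfolding cd(4) using that sM by (intro emeasure_mono) auto
    then have "r * emeasure N {c'<..<d'} \<le> emeasure M {c'<..<d'}" using that(5) by (meson less_imp_le order_trans)
    then have "{c'<..<d'} \<in> dense_intervals r N M a b"
      unfolding dense_intervals_def using that cd(2) by force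
    then have sub: "{c'<..<d'} \<subseteq> ?U" by blast
    have "(c + d)/2 \<in> J \<inter> {c'<..<d'}" using that cd by (auto simp: field_simps)
    then have "J \<inter> {c'<..<d'} \<noteq> {}" by (metis empty_iff)
    then have "{c'<..<d'} \<subseteq> J" by (rule components_maximal[OF J connected_Ioo sub])
    then show ?thesis by (simp add: cd(4))
  qed
  have lt: "r * emeasure N {c<..<d} < emeasure M J" using gt cd(4) by simp
  have "d = b"
  proof (rule ccontr)
    assume "d \<noteq> b"
    then have "d < b" using cd by simp
    have "(\<lambda>n. r * emeasure N {c<..<d + inverse (Suc n)}) \<longlonglongrightarrow> r * emeasure N {c<..<d}"
      using r by (intro ennreal_tendsto_cmult diffuse_tendsto_right N cd(2)) simp
    from order_tendstoD(2)[OF this lt]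
    have 1: "\<forall>\<^sub>F n in sequentially. r * emeasure N {c<..<d + inverse (Suc n)} < emeasure M J" .
    have 2: "\<forall>\<^sub>F n in sequentially. inverse (real (Suc n)) < b - d"
      using order_tendstoD(2)[OF LIMSEQ_inverse_real_of_nat] \<open>d < b\<close> by simp
    obtain n where n: "r * emeasure N {c<..<d + inverse (Suc n)} < emeasure M J" "inverse (real (Suc n)) < b - d"
      using eventually_happens'[OF sequentially_bot eventually_conj[OF 1 2]] by blast
    have "{c<..<d + inverse (Suc n)} \<subseteq> {c<..<d}"
      using n cd by (intro max) auto
    moreover have "d \<in> {c<..<d + inverse (Suc n)}" using cd by simp
    ultimately have "d \<in> {c<..<d}" by (rule subsetD)
    then show False by simp
  qed
  moreover have "c = a"
  proof (rule ccontr)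
    assume "c \<noteq> a"
    then have "a < c" using cd by simp
    have "(\<lambda>n. r * emeasure N {c - inverse (Suc n)<..<d}) \<longlonglongrightarrow> r * emeasure N {c<..<d}"
      using r by (intro ennreal_tendsto_cmult diffuse_tendsto_left N cd(2)) simp
    from order_tendstoD(2)[OF this lt]
    have 1: "\<forall>\<^sub>F n in sequentially. r * emeasure N {c - inverse (Suc n)<..<d} < emeasure M J" .
    have 2: "\<forall>\<^sub>F n in sequentially. inverse (real (Suc n)) < c - a"
      using order_tendstoD(2)[OF LIMSEQ_inverse_real_of_nat] \<open>a < c\<close> by simp
    obtain n where n: "r * emeasure N {c - inverse (Suc n)<..<d} < emeasure M J" "inverse (real (Suc n)) < c - a"
      using eventually_happens'[OF sequentially_bot eventually_conj[OF 1 2]] by blast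
    have "{c - inverse (Suc n)<..<d} \<subseteq> {c<..<d}"
      using n cd by (intro max) auto
    moreover have "c \<in> {c - inverse (Suc n)<..<d}" using cd by simp
    ultimately have "c \<in> {c<..<d}" by (rule subsetD)
    then show False by simp
  qed
  ultimately show False using gt I cd(4) by simp
qed

lemma diffuse_restricted:
  assumes "diffuse M" "S \<in> sets borel"
  shows "diffuse (density M (indicator S))"
  unfolding diffuse_def
proof (intro conjI allI)
  interpret finite_measure M using assms(1) by (simp add: diffuse_def)
  have sM: "sets M = sets borel" using assms(1) by (simp add: diffuse_def)
  show "sets (density M (indicator S)) = sets borel" by (simp add: sM)
  have e: "emeasure (density M (indicator S)) X = emeasure M (S \<inter> X)" if "X \<in> sets borel" for X
    using emeasure_restricted[of S M X] assms(2) that sM by simp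
  have "space M \<in> sets borel" using sM sets.top by blast
  then show "finite_measure (density M (indicator S))"
    using e[of "space M"] by (intro finite_measureI) (simp add: emeasure_eq_measure)
  fix x
  have "emeasure M (S \<inter> {x}) \<le> emeasure M {x}" by (intro emeasure_mono) (auto simp: sM)
  then show "emeasure (density M (indicator S)) {x} = 0" using e[of "{x}"] assms(1) by (simp add: diffuse_def)
qed

text \<open>
  Enclose \<open>S\<close> in the set \<open>U\<close> where its maximal function with respect to \<open>M\<close> reaches \<open>kap\<close>. The covering
  estimate gives \<open>M(U) \<le> (2/kap) M(S)\<close>, so \<open>U\<close> satisfies the hypothesis with \<open>k\<close> lowered by one; on each
  component of \<open>U\<close> the set \<open>S\<close> has density at most \<open>kap\<close>, so passing from \<open>U\<close> to \<open>S\<close> gains a factor \<open>th\<close>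
  in \<open>N\<close>.
\<close>
lemma geometric_decay_open:
  assumes M: "diffuse M" and N: "diffuse N" and kap: "0 < kap" "kap \<le> 1" and th: "0 \<le> (th::real)"
    and ab: "a < b"
    and step: "\<And>c d S. a \<le> c \<Longrightarrow> c < d \<Longrightarrow> d \<le> b \<Longrightarrow> open S \<Longrightarrow> S \<subseteq> {c<..<d} \<Longrightarrow>
        emeasure M S \<le> ennreal kap * emeasure M {c<..<d} \<Longrightarrow>
        emeasure N S \<le> ennreal th * emeasure N {c<..<d}"
    and S: "open S" "S \<subseteq> {a<..<b}"
    and le: "emeasure M S \<le> ennreal (kap * (kap / 2) ^ k) * emeasure M {a<..<b}"
  shows "emeasure N S \<le> ennreal (th ^ Suc k) * emeasure N {a<..<b}"
  using S le
proof (induction k arbitrary: S)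
  case 0
  then show ?case using step[of a b S] ab by simp
next
  case (Suc k)
  have sM: "sets M = sets borel" and sN: "sets N = sets borel" using M N by (simp_all add: diffuse_def)
  have Sb: "S \<in> sets borel" using Suc.prems by auto
  define MS where "MS = density M (indicator S)"
  define NS where "NS = density N (indicator S)"
  have eMS: "emeasure MS X = emeasure M (S \<inter> X)" if "X \<in> sets borel" for X
    unfolding MS_def using emeasure_restricted[of S M X] Sb that sM by simp
  have eNS: "emeasure NS X = emeasure N (S \<inter> X)" if "X \<in> sets borel" for X
    unfolding NS_def using emeasure_restricted[of S N X] Sb that sN by simp
  have dMS: "diffuse MS" unfolding MS_def by (rule diffuse_restricted[OF M Sb])
  have sMS: "sets MS = sets borel" and sNS: "sets NS = sets borel" by (simp_all add: MS_def NS_def sM sN)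
  let ?F = "dense_intervals (ennreal kap) M MS a b"
  let ?U = "\<Union>?F"
  have oU: "open ?U" by (rule open_Union_dense_intervals)
  have UI: "?U \<subseteq> {a<..<b}" by (rule Union_dense_intervals_subset)
  have SU: "S \<subseteq> ?U"
  proof
    fix x assume x: "x \<in> S"
    obtain e where e: "e > 0" "ball x e \<subseteq> S" using Suc.prems(1) x openE by blast
    have bx: "ball x e = {x - e<..<x + e}" by (auto simp: dist_real_def)
    define c d where "c = x - e" and "d = x + e"
    have cd: "{c<..<d} \<subseteq> S" "c < d" "x \<in> {c<..<d}" using e bx by (auto simp: c_def d_def)
    then have "{c<..<d} \<subseteq> {a<..<b}" using Suc.prems(2) by blast
    then have ac: "a \<le> c" "d \<le> b" using cd(2) by (simp_all add: greaterThanLessThan_subseteq_greaterThanLessThan)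
    have "S \<inter> {c<..<d} = {c<..<d}" using cd by auto
    then have "ennreal kap * emeasure M {c<..<d} \<le> emeasure MS {c<..<d}"
      using eMS[of "{c<..<d}"] mult_right_mono[of "ennreal kap" 1 "emeasure M {c<..<d}"] kap by simp
    then have "{c<..<d} \<in> ?F" unfolding dense_intervals_def using ac cd(2) by blast
    then show "x \<in> ?U" using cd(3) by blast
  qed
  have "ennreal (kap * (kap / 2) ^ Suc k) \<le> ennreal kap"
    using kap by (intro ennreal_leI mult_left_le power_le_one) auto
  then have MSI: "emeasure M S \<le> ennreal kap * emeasure M {a<..<b}"
    using Suc.prems(3) mult_right_mono order_trans zero_le by metis
  have "S \<inter> {a<..<b} = S" using Suc.prems(2) by auto
  then have top: "emeasure MS {a<..<b} \<le> ennreal kap * emeasure M {a<..<b}" using MSI eMS by simp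
  have comp: "emeasure MS J \<le> ennreal kap * emeasure M J" if "J \<in> components ?U" for J
    by (rule component_dense_intervals_le[OF dMS M _ top that]) simp
  have "emeasure M ?U \<le> 2 * ennreal (1 / kap) * emeasure MS ?U"
  proof (rule emeasure_Union_intervals_le[OF sM sMS])
    fix J assume J: "J \<in> ?F"
    then show "\<exists>c d. J = {c<..<d}" by (blast elim: dense_intervalsE)
    have "ennreal (1/kap) * (ennreal kap * emeasure M J) \<le> ennreal (1 / kap) * emeasure MS J"
      using J by (intro mult_left_mono) (auto elim: dense_intervalsE)
    also have "ennreal (1/kap) * (ennreal kap * emeasure M J) = emeasure M J"
      using kap by (simp add: mult.assoc[symmetric] ennreal_mult[symmetric])
    finally show "emeasure M J \<le> ennreal (1 / kap) * emeasure MS J" .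
  qed
  also have "emeasure MS ?U = emeasure M S" using eMS[of ?U] oU SU by (simp add: Int_absorb2)
  also have "2 * ennreal (1 / kap) * emeasure M S
      \<le> 2 * ennreal (1 / kap) * (ennreal (kap * (kap / 2) ^ Suc k) * emeasure M {a<..<b})"
    using Suc.prems(3) by (intro mult_left_mono) auto
  also have "\<dots> = ennreal (2 * (1 / kap) * (kap * (kap / 2) ^ Suc k)) * emeasure M {a<..<b}"
  proof -
    have "ennreal (2 * (1 / kap) * (kap * (kap / 2) ^ Suc k))
        = ennreal 2 * ennreal (1 / kap) * ennreal (kap * (kap / 2) ^ Suc k)"
      using kap by (subst ennreal_mult[symmetric]; simp)+
    then show ?thesis by (simp only: mult.assoc ennreal_numeral)
  qed
  also have "2 * (1 / kap) * (kap * (kap / 2) ^ Suc k) = kap * (kap / 2) ^ k"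
    using kap by simp
  finally have "emeasure N ?U \<le> ennreal (th ^ Suc k) * emeasure N {a<..<b}"
    using Suc.IH[OF oU UI] by simp
  moreover have "emeasure NS ?U \<le> ennreal th * emeasure N ?U"
  proof (rule emeasure_le_if_on_components[OF oU sNS sN])
    fix J assume J: "J \<in> components ?U"
    obtain c d where cd: "a \<le> c" "c < d" "d \<le> b" "J = {c<..<d}"
      using open_component_interval[OF oU J UI] by blast
    have "emeasure N (S \<inter> J) \<le> ennreal th * emeasure N J"
      unfolding cd(4) using comp[OF J] cd eMS[of J] Suc.prems(1) by (intro step) auto
    then show "emeasure NS J \<le> ennreal th * emeasure N J" using eNS[of J] cd(4) by simp
  qed
  moreover have "emeasure NS ?U = emeasure N S" using eNS[of ?U] oU SU by (simp add: Int_absorb2)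
  ultimately have "emeasure N S \<le> ennreal th * (ennreal (th ^ Suc k) * emeasure N {a<..<b})"
    by (metis mult_left_mono order_trans zero_le)
  also have "\<dots> = ennreal (th ^ Suc (Suc k)) * emeasure N {a<..<b}"
    using th by (simp add: ennreal_mult mult.assoc)
  finally show ?case .
qed

text \<open>
  Outer regularity of \<open>M\<close> extends the decay to Borel sets. The bound \<open>(kap/2)\<^sup>k\<close>, which is half of the
  one for open sets, leaves room for an enclosing open set of slightly larger mass.
\<close>
lemma geometric_decay:
  assumes M: "diffuse M" and N: "diffuse N" and kap: "0 < kap" "kap \<le> 1" and th: "0 \<le> (th::real)"
    and ab: "a < b"
    and step: "\<And>c d S. a \<le> c \<Longrightarrow> c < d \<Longrightarrow> d \<le> b \<Longrightarrow> open S \<Longrightarrow> S \<subseteq> {c<..<d} \<Longrightarrow>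
        emeasure M S \<le> ennreal kap * emeasure M {c<..<d} \<Longrightarrow>
        emeasure N S \<le> ennreal th * emeasure N {c<..<d}"
    and pos: "0 < emeasure M {a<..<b}"
    and S: "S \<in> sets borel" "S \<subseteq> {a<..<b}"
    and le: "emeasure M S \<le> ennreal ((kap / 2) ^ k) * emeasure M {a<..<b}"
  shows "emeasure N S \<le> ennreal (th ^ k) * emeasure N {a<..<b}"
proof (cases k)
  case 0
  have "emeasure N S \<le> emeasure N {a<..<b}" using S N by (intro emeasure_mono) (auto simp: diffuse_def)
  then show ?thesis using 0 by simp
next
  case (Suc m)
  interpret finite_measure M using M by (simp add: diffuse_def)
  have sM: "sets M = sets borel" and sN: "sets N = sets borel" using M N by (simp_all add: diffuse_def)
  have q: "(kap / 2) ^ k < kap * (kap / 2) ^ m" using kap by (simp add: Suc)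
  obtain p where p: "emeasure M {a<..<b} = ennreal p" "p > 0"
    using pos by (metis emeasure_eq_measure ennreal_0 ennreal_less_zero_iff)
  have "ennreal ((kap / 2) ^ k) * emeasure M {a<..<b} < ennreal (kap * (kap / 2) ^ m) * emeasure M {a<..<b}"
    unfolding p(1) using q p(2) kap by (simp add: ennreal_mult[symmetric] ennreal_less_iff)
  then have "emeasure M S < ennreal (kap * (kap / 2) ^ m) * emeasure M {a<..<b}" using le by simp
  moreover have "emeasure M S = (INF U \<in> {U. S \<subseteq> U \<and> open U}. emeasure M U)"
    using outer_regular[OF sM _ S(1)] by (simp add: emeasure_eq_measure)
  ultimately obtain Q where Q: "S \<subseteq> Q" "open Q" "emeasure M Q < ennreal (kap * (kap / 2) ^ m) * emeasure M {a<..<b}"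
    by (auto simp: INF_less_iff)
  have "emeasure M (Q \<inter> {a<..<b}) \<le> emeasure M Q" using Q by (intro emeasure_mono) (auto simp: sM)
  then have "emeasure N (Q \<inter> {a<..<b}) \<le> ennreal (th ^ Suc m) * emeasure N {a<..<b}"
    using Q by (intro geometric_decay_open[OF M N kap th ab step]) auto
  moreover have "emeasure N S \<le> emeasure N (Q \<inter> {a<..<b})"
    using S Q by (intro emeasure_mono) (auto simp: sN)
  ultimately show ?thesis using Suc by simp
qed

text \<open>
  Interpolates the geometric decay: the exponent is chosen so that \<open>kap/2\<close> raised to it equals \<open>th\<close>, and
  the factor \<open>1/th\<close> absorbs the rounding of \<open>e\<close> to a power of \<open>kap/2\<close>.
\<close>
lemma power_decay:
  assumes M: "diffuse M" and N: "diffuse N" and kap: "0 < kap" "kap \<le> 1" and th: "0 < th" "th < (1::real)"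
    and ab: "a < b"
    and step: "\<And>c d S. a \<le> c \<Longrightarrow> c < d \<Longrightarrow> d \<le> b \<Longrightarrow> open S \<Longrightarrow> S \<subseteq> {c<..<d} \<Longrightarrow>
        emeasure M S \<le> ennreal kap * emeasure M {c<..<d} \<Longrightarrow>
        emeasure N S \<le> ennreal th * emeasure N {c<..<d}"
    and pos: "0 < emeasure M {a<..<b}"
    and S: "S \<in> sets borel" "S \<subseteq> {a<..<b}"
    and e: "0 < e" "e \<le> 1"
    and le: "emeasure M S \<le> ennreal e * emeasure M {a<..<b}"
  shows "emeasure N S \<le> ennreal (1 / th * e powr (ln th / ln (kap / 2))) * emeasure N {a<..<b}"
proof -
  let ?q = "kap / 2"
  have q: "0 < ?q" "?q < 1" using kap by auto
  define n where "n = (LEAST n. ?q ^ n < e)"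
  have ex: "\<exists>n. ?q ^ n < e" using real_arch_pow_inv[OF e(1) q(2)] .
  have n: "?q ^ n < e" unfolding n_def using ex by (rule LeastI_ex)
  have "n \<noteq> 0" using n e by (cases n) auto
  then obtain k where k: "n = Suc k" using not0_implies_Suc by blast
  have "\<not> ?q ^ k < e" using not_less_Least[of k "\<lambda>n. ?q ^ n < e"] k unfolding n_def by simp
  then have "ennreal e \<le> ennreal (?q ^ k)" by (intro ennreal_leI) simp
  then have "emeasure M S \<le> ennreal (?q ^ k) * emeasure M {a<..<b}"
    using le by (meson mult_right_mono order_trans zero_le)
  then have *: "emeasure N S \<le> ennreal (th ^ k) * emeasure N {a<..<b}"
    using th by (intro geometric_decay[OF M N kap _ ab step pos S]) auto
  let ?d = "ln th / ln ?q"
  have d: "0 < ?d" using q th by (simp add: divide_neg_neg)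
  have "?q powr ?d = th" using q th by (simp add: powr_def)
  then have "th ^ n = (?q ^ n) powr ?d"
  proof -
    have "th ^ n = (?q powr ?d) powr real n" using \<open>?q powr ?d = th\<close> th by (simp only: powr_realpow)
    also have "\<dots> = (?q powr real n) powr ?d" by (simp only: powr_powr mult.commute)
    also have "?q powr real n = ?q ^ n" using q by (simp only: powr_realpow)
    finally show ?thesis .
  qed
  also have "\<dots> \<le> e powr ?d" using n q d by (intro powr_mono2) auto
  finally have "th ^ k \<le> 1 / th * e powr ?d" using th k by (simp add: field_simps)
  then show ?thesis using * by (meson ennreal_leI mult_right_mono order_trans zero_le)
qed

section \<open>Weights for which small sets carry at most half the mass\<close>

text \<open>
  A form of the Muckenhoupt condition \<open>A\<^sub>\<infinity>\<close> that is linear in \<open>v\<close>, hence preserved when weights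
  sharing the same \<open>\<eta>\<close> are averaged.
\<close>
definition halving :: "real \<Rightarrow> (real \<Rightarrow> ennreal) \<Rightarrow> bool" where
  "halving \<eta> v \<longleftrightarrow> (\<forall>c d. \<forall>S\<in>sets borel. c < d \<longrightarrow> S \<subseteq> {c<..<d} \<longrightarrow>
      emeasure lborel S \<le> ennreal (\<eta> * (d - c)) \<longrightarrow>
      2 * (\<integral>\<^sup>+t\<in>S. v t \<partial>lborel) \<le> (\<integral>\<^sup>+t\<in>{c<..<d}. v t \<partial>lborel))"

lemma halvingD:
  assumes "halving \<eta> v" "S \<in> sets borel" "c < d" "S \<subseteq> {c<..<d}" "emeasure lborel S \<le> ennreal (\<eta> * (d - c))"
  shows "2 * (\<integral>\<^sup>+t\<in>S. v t \<partial>lborel) \<le> (\<integral>\<^sup>+t\<in>{c<..<d}. v t \<partial>lborel)"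
  using assms unfolding halving_def by blast

text \<open>
  The measure with density \<open>v\<close>, cut off to an interval so as to be finite; the constant weight one
  gives Lebesgue measure on the interval.
\<close>
definition local_measure :: "(real \<Rightarrow> ennreal) \<Rightarrow> real \<Rightarrow> real \<Rightarrow> real measure" where
  "local_measure v a b = density lborel (\<lambda>t. v t * indicator {a<..<b} t)"

lemma sets_local_measure [simp]: "sets (local_measure v a b) = sets borel"
  by (simp add: local_measure_def)

lemma emeasure_local_measure:
  assumes "v \<in> borel_measurable borel" "S \<in> sets borel" "S \<subseteq> {a<..<b}"
  shows "emeasure (local_measure v a b) S = (\<integral>\<^sup>+t\<in>S. v t \<partial>lborel)"
proof -
  have "emeasure (local_measure v a b) S = (\<integral>\<^sup>+t. v t * indicator {a<..<b} t * indicator S t \<partial>lborel)"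
    unfolding local_measure_def using assms by (subst emeasure_density) auto
  also have "\<dots> = (\<integral>\<^sup>+t\<in>S. v t \<partial>lborel)"
    using assms(3) by (intro nn_integral_cong) (auto simp: indicator_def)
  finally show ?thesis .
qed

lemma emeasure_local_measure_lborel:
  assumes "S \<in> sets borel" "S \<subseteq> {a<..<b}"
  shows "emeasure (local_measure (\<lambda>_. 1) a b) S = emeasure lborel S"
  using assms by (simp add: emeasure_local_measure)

lemma diffuse_local_measure:
  assumes "v \<in> borel_measurable borel" "(\<integral>\<^sup>+t\<in>{a<..<b}. v t \<partial>lborel) < \<infinity>"
  shows "diffuse (local_measure v a b)"
  unfolding diffuse_def
proof (intro conjI allI)
  have "emeasure (local_measure v a b) UNIV = (\<integral>\<^sup>+t\<in>{a<..<b}. v t \<partial>lborel)"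
    unfolding local_measure_def using assms by (subst emeasure_density) auto
  then show "finite_measure (local_measure v a b)"
    using assms(2) by (intro finite_measureI) (simp add: local_measure_def)
  fix x
  show "emeasure (local_measure v a b) {x} = 0"
    unfolding local_measure_def using assms by (subst emeasure_density) (auto intro!: nn_integral_null_set simp: null_sets_def)
qed simp

lemma diffuse_local_lborel: "diffuse (local_measure (\<lambda>_. 1) a b)"
  by (rule diffuse_local_measure) (cases "a \<le> b"; simp)+

lemma ennreal_half_le_iff: "X \<le> ennreal (1/2) * Y \<longleftrightarrow> 2 * X \<le> (Y::ennreal)"
proof -
  have e: "ennreal (1/2) * 2 = 1"
    by (metis ennreal_1 ennreal_mult ennreal_numeral field_sum_of_halves mult_2_right nonzero_mult_div_cancel_left times_divide_eq_left zero_le_numeral zero_neq_numeral divide_nonneg_nonneg zero_le_one mult.commute)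
  show ?thesis
  proof
    assume "X \<le> ennreal (1/2) * Y"
    then have "2 * X \<le> 2 * (ennreal (1/2) * Y)" by (rule mult_left_mono) simp
    then show "2 * X \<le> Y" using e by (metis mult.assoc mult.commute mult_1)
  next
    assume "2 * X \<le> Y"
    then have "ennreal (1/2) * (2 * X) \<le> ennreal (1/2) * Y" by (rule mult_left_mono) simp
    then show "X \<le> ennreal (1/2) * Y" using e by (metis mult.assoc mult_1)
  qed
qed

lemma halving_power_law:
  assumes v: "v \<in> borel_measurable borel" and fin: "(\<integral>\<^sup>+t\<in>{a<..<b}. v t \<partial>lborel) < \<infinity>"
    and h: "halving \<eta> v" and eta: "0 < \<eta>" "\<eta> \<le> 1" and ab: "a < b"
    and S: "S \<in> sets borel" "S \<subseteq> {a<..<b}" and e: "0 < e" "e \<le> 1"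
    and le: "emeasure lborel S \<le> ennreal (e * (b - a))"
  shows "(\<integral>\<^sup>+t\<in>S. v t \<partial>lborel) \<le> ennreal (2 * e powr (ln (1/2) / ln (\<eta>/2))) * (\<integral>\<^sup>+t\<in>{a<..<b}. v t \<partial>lborel)"
proof -
  let ?M = "local_measure (\<lambda>_. 1) a b" and ?N = "local_measure v a b"
  have eM: "emeasure ?M X = emeasure lborel X" if "X \<in> sets borel" "X \<subseteq> {a<..<b}" for X
    using that by (rule emeasure_local_measure_lborel)
  have eN: "emeasure ?N X = (\<integral>\<^sup>+t\<in>X. v t \<partial>lborel)" if "X \<in> sets borel" "X \<subseteq> {a<..<b}" for X
    using v that by (rule emeasure_local_measure)
  have "emeasure ?N S \<le> ennreal (1 / (1/2) * e powr (ln (1/2) / ln (\<eta> / 2))) * emeasure ?N {a<..<b}"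
  proof (rule power_decay[OF diffuse_local_lborel diffuse_local_measure[OF v fin] eta _ _ ab _ _ S e])
    fix c d T assume cd: "a \<le> c" "c < d" "d \<le> b" and T: "open T" "T \<subseteq> {c<..<d}"
      and le: "emeasure ?M T \<le> ennreal \<eta> * emeasure ?M {c<..<d}"
    have sub: "{c<..<d} \<subseteq> {a<..<b}" "T \<subseteq> {a<..<b}" using cd T by auto
    have "emeasure lborel T \<le> ennreal (\<eta> * (d - c))"
      using le sub T cd eta by (simp add: eM ennreal_mult)
    from halvingD[OF h _ cd(2) T(2) this] T(1)
    show "emeasure ?N T \<le> ennreal (1/2) * emeasure ?N {c<..<d}"
      using sub by (simp only: eN borel_open open_greaterThanLessThan ennreal_half_le_iff)
  qed (use ab le e S in \<open>auto simp: eM ennreal_mult\<close>)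
  then show ?thesis using S by (simp add: eN)
qed

text \<open>
  A halving weight cannot vanish on an interval without vanishing altogether: the zero interval can be
  lengthened at both ends by \<open>\<eta>/2\<close> times its length, since the added part then carries at most half of
  its own mass. Finitely many steps exhaust the interval from \<open>a\<close> to \<open>b\<close>.
\<close>
lemma halving_positive:
  assumes v: "v \<in> borel_measurable borel" and fin: "(\<integral>\<^sup>+t\<in>{a<..<b}. v t \<partial>lborel) < \<infinity>"
    and h: "halving \<eta> v" and eta: "0 < \<eta>"
    and cd: "a \<le> c" "c < d" "d \<le> b" and zero: "(\<integral>\<^sup>+t\<in>{c<..<d}. v t \<partial>lborel) = 0"
  shows "(\<integral>\<^sup>+t\<in>{a<..<b}. v t \<partial>lborel) = 0"
proof -
  let ?N = "local_measure v a b"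
  have eN: "emeasure ?N X = (\<integral>\<^sup>+t\<in>X. v t \<partial>lborel)" if "X \<in> sets borel" "X \<subseteq> {a<..<b}" for X
    using v that by (rule emeasure_local_measure)
  interpret finite_measure ?N using diffuse_local_measure[OF v fin] by (simp add: diffuse_def)
  define s where "s = \<eta> / 2 * (d - c)"
  have s: "0 < s" using eta cd by (simp add: s_def)
  define p where "p n = max a (c - real n * s)" for n
  define q where "q n = min b (d + real n * s)" for n
  have pq: "a \<le> p n" "p n \<le> c" "d \<le> q n" "q n \<le> b" "p (Suc n) \<le> p n" "q n \<le> q (Suc n)"
    "p n - p (Suc n) \<le> s" "q (Suc n) - q n \<le> s" for n
  proof -
    have "0 \<le> real n * s" "real (Suc n) * s = real n * s + s" using s by (auto simp: algebra_simps)
    then show "a \<le> p n" "p n \<le> c" "d \<le> q n" "q n \<le> b" "p (Suc n) \<le> p n" "q n \<le> q (Suc n)"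
    "p n - p (Suc n) \<le> s" "q (Suc n) - q n \<le> s" unfolding p_def q_def using cd s by linarith+
  qed
  have z: "emeasure ?N {p n<..<q n} = 0" for n
  proof (induction n)
    case 0
    have "p 0 = c" "q 0 = d" using cd by (auto simp: p_def q_def)
    then show ?case using zero cd by (subst eN) auto
  next
    case (Suc n)
    define T where "T = {p (Suc n)<..<q (Suc n)} - {p n<..<q n}"
    have Tb: "T \<in> sets borel" "T \<subseteq> {p (Suc n)<..<q (Suc n)}" by (auto simp: T_def)
    have sub: "{p (Suc n)<..<q (Suc n)} \<subseteq> {a<..<b}" using pq(1)[of "Suc n"] pq(4)[of "Suc n"] by auto
    have lt: "p (Suc n) < q (Suc n)" using pq(2)[of "Suc n"] pq(3)[of "Suc n"] cd by linarith
    have "T \<subseteq> {p (Suc n)..p n} \<union> {q n..q (Suc n)}" unfolding T_def by auto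
    then have "emeasure lborel T \<le> emeasure lborel ({p (Suc n)..p n} \<union> {q n..q (Suc n)})"
      by (intro emeasure_mono) auto
    also have "\<dots> \<le> emeasure lborel {p (Suc n)..p n} + emeasure lborel {q n..q (Suc n)}"
      by (intro emeasure_subadditive) auto
    also have "\<dots> = ennreal ((p n - p (Suc n)) + (q (Suc n) - q n))"
      using pq(5)[of n] pq(6)[of n] by (simp add: ennreal_plus)
    also have "\<dots> \<le> ennreal (\<eta> * (q (Suc n) - p (Suc n)))"
    proof (intro ennreal_leI)
      have "(p n - p (Suc n)) + (q (Suc n) - q n) \<le> \<eta> * (d - c)" using pq(7)[of n] pq(8)[of n] by (simp add: s_def)
      also have "\<dots> \<le> \<eta> * (q (Suc n) - p (Suc n))"
        using eta pq(2)[of "Suc n"] pq(3)[of "Suc n"] by (intro mult_left_mono) auto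
      finally show "(p n - p (Suc n)) + (q (Suc n) - q n) \<le> \<eta> * (q (Suc n) - p (Suc n))" .
    qed
    finally have "2 * emeasure ?N T \<le> emeasure ?N {p (Suc n)<..<q (Suc n)}"
      using halvingD[OF h Tb(1) lt Tb(2)] Tb sub by (simp add: eN subset_trans[OF Tb(2) sub])
    also have U: "{p (Suc n)<..<q (Suc n)} = T \<union> {p n<..<q n}"
      unfolding T_def using pq(5)[of n] pq(6)[of n] by auto
    also have U2: "emeasure ?N (T \<union> {p n<..<q n}) = emeasure ?N T"
      using Suc Tb by (intro emeasure_Un_null_set) (auto simp: null_sets_def)
    finally have "2 * measure ?N T \<le> measure ?N T"
      by (simp add: emeasure_eq_measure ennreal_mult'[symmetric] flip: ennreal_numeral)
    then have "measure ?N T = 0" using measure_nonneg[of ?N T] by linarith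
    then show ?case using U U2 by (simp add: emeasure_eq_measure)
  qed
  obtain n where n: "(b - a) / s < real n" using reals_Archimedean2 by blast
  then have "b - a < real n * s" using s by (simp add: field_simps)
  then have "p n = a" "q n = b" using cd by (auto simp: p_def q_def)
  then show ?thesis using z[of n] eN[of "{a<..<b}"] by simp
qed

text \<open>
  Seen from the weighted measure, Lebesgue measure satisfies the hypothesis of the iteration as
  well: if \<open>T\<close> carries at most a quarter of the mass, its complement carries more than half of it, so the
  complement cannot be \<open>\<eta>\<close>-small, and \<open>|T|\<close> is at most the fraction \<open>1 - \<eta>\<close> of the length. This
  needs every subinterval to have positive mass.
\<close>
lemma halving_reverse_power_law:
  assumes v: "v \<in> borel_measurable borel" and fin: "(\<integral>\<^sup>+t\<in>{a<..<b}. v t \<partial>lborel) < \<infinity>"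
    and h: "halving \<eta> v" and eta: "0 < \<eta>" "\<eta> < 1" and ab: "a < b"
    and pos: "0 < (\<integral>\<^sup>+t\<in>{a<..<b}. v t \<partial>lborel)"
    and S: "S \<in> sets borel" "S \<subseteq> {a<..<b}" and e: "0 < e" "e \<le> 1"
    and le: "(\<integral>\<^sup>+t\<in>S. v t \<partial>lborel) \<le> ennreal e * (\<integral>\<^sup>+t\<in>{a<..<b}. v t \<partial>lborel)"
  shows "emeasure lborel S \<le> ennreal (1 / (1 - \<eta>) * e powr (ln (1 - \<eta>) / ln (1/8)) * (b - a))"
proof -
  let ?N = "local_measure (\<lambda>_. 1) a b" and ?M = "local_measure v a b"
  have eN: "emeasure ?N X = emeasure lborel X" if "X \<in> sets borel" "X \<subseteq> {a<..<b}" for X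
    using that by (rule emeasure_local_measure_lborel)
  have eM: "emeasure ?M X = (\<integral>\<^sup>+t\<in>X. v t \<partial>lborel)" if "X \<in> sets borel" "X \<subseteq> {a<..<b}" for X
    using v that by (rule emeasure_local_measure)
  interpret M: finite_measure ?M using diffuse_local_measure[OF v fin] by (simp add: diffuse_def)
  have "emeasure ?N S \<le> ennreal (1 / (1 - \<eta>) * e powr (ln (1 - \<eta>) / ln (1/4 / 2))) * emeasure ?N {a<..<b}"
  proof (rule power_decay[OF diffuse_local_measure[OF v fin] diffuse_local_lborel _ _ _ _ ab _ _ S e])
    fix c d T assume cd: "a \<le> c" "c < d" "d \<le> b" and T: "open T" "T \<subseteq> {c<..<d}"
      and le: "emeasure ?M T \<le> ennreal (1/4) * emeasure ?M {c<..<d}"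
    have sub: "{c<..<d} \<subseteq> {a<..<b}" "T \<subseteq> {a<..<b}" "{c<..<d} - T \<subseteq> {a<..<b}" using cd T by auto
    have Tb: "T \<in> sets borel" using T by auto
    have "(\<integral>\<^sup>+t\<in>{c<..<d}. v t \<partial>lborel) \<noteq> 0"
      using halving_positive[OF v fin h eta(1) cd] pos by auto
    then have "emeasure ?M {c<..<d} \<noteq> 0" using sub(1) by (simp add: eM)
    then have mpos: "0 < measure ?M {c<..<d}"
      by (simp add: M.emeasure_eq_measure ennreal_eq_0_iff zero_less_measure_iff)
    have m1: "measure ?M T \<le> 1/4 * measure ?M {c<..<d}"
      using le by (simp add: M.emeasure_eq_measure ennreal_mult'[symmetric])
    have m2: "measure ?M ({c<..<d} - T) = measure ?M {c<..<d} - measure ?M T"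
      using T Tb by (intro M.finite_measure_Diff) auto
    have "\<not> emeasure lborel ({c<..<d} - T) \<le> ennreal (\<eta> * (d - c))"
    proof
      assume *: "emeasure lborel ({c<..<d} - T) \<le> ennreal (\<eta> * (d - c))"
      have "2 * emeasure ?M ({c<..<d} - T) \<le> emeasure ?M {c<..<d}"
        using halvingD[OF h _ cd(2) _ *] Tb sub by (simp add: eM)
      then have "2 * measure ?M ({c<..<d} - T) \<le> measure ?M {c<..<d}"
        by (simp add: M.emeasure_eq_measure ennreal_mult'[symmetric] flip: ennreal_numeral)
      then show False using m1 m2 mpos by linarith
    qed
    moreover have "emeasure lborel {c<..<d} = emeasure lborel T + emeasure lborel ({c<..<d} - T)"
      using T Tb by (subst plus_emeasure) (auto simp: Un_absorb1)
    moreover have finX: "emeasure lborel X < \<infinity>" if "X \<subseteq> {c<..<d}" for X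
      by (rule le_less_trans[OF emeasure_mono[OF that]]) (use cd in auto)
    moreover have "emeasure lborel T < \<infinity>" "emeasure lborel ({c<..<d} - T) < \<infinity>"
      using T by (intro finX; auto)+
    moreover obtain m n where mn: "emeasure lborel T = ennreal m" "emeasure lborel ({c<..<d} - T) = ennreal n"
        "0 \<le> m" "0 \<le> n"
      using calculation(4,5) by (cases "emeasure lborel T"; cases "emeasure lborel ({c<..<d} - T)") auto
    ultimately have "\<not> n \<le> \<eta> * (d - c)" "ennreal (d - c) = ennreal (m + n)"
      using cd by (auto simp: ennreal_leI ennreal_plus simp del: ennreal_plus[symmetric])
    then have "\<not> n \<le> \<eta> * (d - c)" "d - c = m + n"
      using cd mn by (auto simp del: ennreal_plus)
    then have "m \<le> (1 - \<eta>) * (d - c)" by (simp add: left_diff_distrib)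
    then have "emeasure lborel T \<le> ennreal ((1 - \<eta>) * (d - c))" unfolding mn(1) by (rule ennreal_leI)
    then show "emeasure ?N T \<le> ennreal (1 - \<eta>) * emeasure ?N {c<..<d}"
      using sub Tb cd eta by (simp add: eN ennreal_mult)
  qed (use ab le e S eta pos in \<open>auto simp: eM\<close>)
  also have "1/4 / 2 = (1/8::real)" by simp
  finally have "emeasure lborel S \<le> ennreal (1 / (1 - \<eta>) * e powr (ln (1 - \<eta>) / ln (1 / 8))) * ennreal (b - a)"
    using S ab by (simp add: eN)
  also have "\<dots> = ennreal (1 / (1 - \<eta>) * e powr (ln (1 - \<eta>) / ln (1 / 8)) * (b - a))"
    using ab eta by (intro ennreal_mult[symmetric]) auto
  finally show ?thesis .
qed

section \<open>The Fujii--Wilson condition, and halos on the line\<close>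

lemma maximal1_ge:
  assumes "p < q" "p \<le> x" "x \<le> q" "l > 0"
    and "ennreal (l * (q - p)) \<le> (\<integral>\<^sup>+t\<in>{p..q}. ennreal \<bar>f t\<bar> \<partial>lborel)"
  shows "ennreal l \<le> maximal1 f x"
proof -
  have "ennreal l = ennreal (l * (q - p)) / ennreal (q - p)"
    using assms by (subst divide_ennreal) auto
  also have "\<dots> \<le> (\<integral>\<^sup>+t\<in>{p..q}. ennreal \<bar>f t\<bar> \<partial>lborel) / ennreal (q - p)"
    using assms(5) by (rule divide_right_mono_ennreal)
  also have "\<dots> = (\<integral>\<^sup>+t\<in>{p..q}. ennreal \<bar>f t\<bar> \<partial>lebesgue) / emeasure lebesgue {p..q}"
    using assms by (simp add: nn_integral_completion)
  also have "\<dots> \<le> maximal1 f x" unfolding maximal1_def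
    using assms by (intro SUP_upper2[of "(p, q)"]) auto
  finally show ?thesis .
qed

lemma set_nn_integral_Icc_eq_Ioo:
  fixes f :: "real \<Rightarrow> ennreal"
  shows "(\<integral>\<^sup>+t\<in>{c..d}. f t \<partial>lborel) = (\<integral>\<^sup>+t\<in>{c<..<d}. f t \<partial>lborel)"
proof (rule nn_integral_cong_AE)
  have "AE t in lborel. t \<noteq> c" "AE t in lborel. t \<noteq> d" by (rule AE_lborel_singleton)+
  then show "AE t in lborel. f t * indicator {c..d} t = f t * indicator {c<..<d} t"
    by eventually_elim (auto simp: indicator_def)
qed

text \<open>
  A geometric sum is at most twice its last term. In the application \<open>m\<close> is a value of the maximal
  function and \<open>P k\<close> says that it reaches level \<open>k\<close>.
\<close>
lemma sum_dyadic_levels_le: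
  fixes m :: ennreal
  assumes m: "\<And>k. k < K \<Longrightarrow> P k \<Longrightarrow> ennreal (2 ^ k * r) \<le> m" and r: "0 \<le> r"
  shows "(\<Sum>k<K. ennreal (2 ^ k * r) * (if P k then 1 else 0)) \<le> 2 * m"
proof (cases "{k. k < K \<and> P k} = {}")
  case True
  then have "(\<Sum>k<K. ennreal (2 ^ k * r) * (if P k then 1 else 0)) = 0" by (intro sum.neutral) auto
  then show ?thesis by (metis zero_le)
next
  case False
  define n where "n = Max {k. k < K \<and> P k}"
  have fin: "finite {k. k < K \<and> P k}" by simp
  have n: "n < K" "P n" using Max_in[OF fin False] by (auto simp: n_def)
  have le: "k \<le> n" if "k < K" "P k" for k using Max_ge[OF fin, of k] that by (auto simp: n_def)
  have "(\<Sum>k<K. ennreal (2 ^ k * r) * (if P k then 1 else 0)) = (\<Sum>k\<in>{k. k < K \<and> P k}. ennreal (2 ^ k * r))"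
    by (intro sum.mono_neutral_cong_right) auto
  also have "\<dots> \<le> (\<Sum>k<Suc n. ennreal (2 ^ k * r))"
    using le by (intro sum_mono2) (auto simp: less_Suc_eq_le)
  also have "\<dots> = ennreal ((\<Sum>k<Suc n. 2 ^ k) * r)"
    using r by (subst sum_ennreal) (auto simp: sum_distrib_right simp del: sum.lessThan_Suc)
  also have "(\<Sum>k<Suc n. (2::real) ^ k) = 2 ^ Suc n - 1" by (subst sum_gp_strict) auto
  also have "ennreal ((2 ^ Suc n - 1) * r) \<le> ennreal (2 * (2 ^ n * r))"
    using r by (intro ennreal_leI) (auto simp: algebra_simps)
  also have "\<dots> = 2 * ennreal (2 ^ n * r)" using r by (simp add: ennreal_mult')
  also have "\<dots> \<le> 2 * m" using m[OF n] by (intro mult_left_mono) auto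
  finally show ?thesis .
qed

text \<open>
  Let \<open>r\<close> be the average of \<open>v\<close> and \<open>U\<^sub>k\<close> the set where its maximal function reaches \<open>2\<^sup>k r\<close>. Components of
  \<open>U\<^sub>k\<close> have average at most \<open>2\<^sup>k r\<close>, and so have the components of \<open>S\<close> that are not contained in \<open>U\<^sub>k\<close>;
  hence \<open>v(S) \<le> 2\<^sup>k r (|U\<^sub>k| + |S|)\<close>. Summing over \<open>k < K\<close>, the terms \<open>2\<^sup>k r |U\<^sub>k|\<close> add up to at most twice
  the integral of the maximal function, which the Fujii--Wilson constant controls.
\<close>
lemma fujii_wilson_open:
  fixes v :: "real \<Rightarrow> real"
  assumes v: "v \<in> borel_measurable borel" and nonneg: "\<And>t. 0 \<le> v t"
    and fin: "(\<integral>\<^sup>+t\<in>{c<..<d}. ennreal (v t) \<partial>lborel) < \<infinity>"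
    and A: "0 \<le> A" "fujii_wilson_const v \<le> ennreal A"
    and cd: "c < d" and S: "open S" "S \<subseteq> {c<..<d}"
    and small: "emeasure lborel S \<le> ennreal ((1/2) ^ K * (d - c))"
  shows "of_nat K * (\<integral>\<^sup>+t\<in>S. ennreal (v t) \<partial>lborel) \<le> ennreal (2 * A + 1) * (\<integral>\<^sup>+t\<in>{c<..<d}. ennreal (v t) \<partial>lborel)"
proof -
  define V where "V = enn2real (\<integral>\<^sup>+t\<in>{c<..<d}. ennreal (v t) \<partial>lborel)"
  have V: "(\<integral>\<^sup>+t\<in>{c<..<d}. ennreal (v t) \<partial>lborel) = ennreal V" "0 \<le> V"
    using fin by (simp_all add: V_def)
  have vm: "(\<lambda>t. ennreal (v t)) \<in> borel_measurable borel" using v by simp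
  let ?N = "local_measure (\<lambda>_. 1) c d" and ?M = "local_measure (\<lambda>t. ennreal (v t)) c d"
  have eN: "emeasure ?N X = emeasure lborel X" if "X \<in> sets borel" "X \<subseteq> {c<..<d}" for X
    using that by (rule emeasure_local_measure_lborel)
  have eM: "emeasure ?M X = (\<integral>\<^sup>+t\<in>X. ennreal (v t) \<partial>lborel)" if "X \<in> sets borel" "X \<subseteq> {c<..<d}" for X
    using vm that by (rule emeasure_local_measure)
  have Sb: "S \<in> sets borel" using S by auto
  show ?thesis
  proof (cases "V = 0")
    case True
    have "emeasure ?M S \<le> emeasure ?M {c<..<d}" using S by (intro emeasure_mono) auto
    then show ?thesis using True V S Sb by (simp add: eM)
  next
    case False
    then have Vpos: "0 < V" using V by simp
    define r where "r = V / (d - c)"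
    have r: "0 < r" "r * (d - c) = V" using Vpos cd by (auto simp: r_def)
    define Mx where "Mx = maximal1 (\<lambda>y. v y * indicator {c..d} y)"
    define U where "U k = \<Union>(dense_intervals (ennreal (2 ^ k * r)) ?N ?M c d)" for k
    have U: "open (U k)" "U k \<subseteq> {c<..<d}" for k
      unfolding U_def by (rule open_Union_dense_intervals Union_dense_intervals_subset)+
    have Ub: "U k \<in> sets borel" for k using U by auto
    have Mx_ge: "ennreal (2 ^ k * r) \<le> Mx x" if xU: "x \<in> U k" for k x
    proof -
      obtain J where J: "x \<in> J" "J \<in> dense_intervals (ennreal (2 ^ k * r)) ?N ?M c d"
        using xU unfolding U_def by blast
      obtain p q where pq: "c \<le> p" "p < q" "q \<le> d" "J = {p<..<q}"
        "ennreal (2 ^ k * r) * emeasure ?N J \<le> emeasure ?M J" using dense_intervalsE[OF J(2)] by blast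
      have sub: "{p<..<q} \<subseteq> {c<..<d}" using pq by auto
      have "ennreal (2 ^ k * r * (q - p)) = ennreal (2 ^ k * r) * emeasure ?N J"
        using pq r sub by (simp add: eN ennreal_mult)
      also have "\<dots> \<le> emeasure ?M J" by (rule pq)
      also have "\<dots> = (\<integral>\<^sup>+t\<in>{p..q}. ennreal (v t) \<partial>lborel)"
        using sub pq by (simp add: eM set_nn_integral_Icc_eq_Ioo)
      also have "\<dots> = (\<integral>\<^sup>+t\<in>{p..q}. ennreal \<bar>v t * indicator {c..d} t\<bar> \<partial>lborel)"
        using pq nonneg by (intro nn_integral_cong) (auto simp: indicator_def)
      finally show ?thesis unfolding Mx_def
        using pq J(1) r by (intro maximal1_ge[of p q]) auto
    qed
    have level: "emeasure ?M S \<le> ennreal (2 ^ k * r) * (emeasure lborel (U k) + emeasure lborel S)" for k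
    proof -
      let ?l = "ennreal (2 ^ k * r)"
      have V_le: "emeasure ?M {c<..<d} \<le> ?l * emeasure ?N {c<..<d}"
      proof -
        have "V \<le> 2 ^ k * r * (d - c)"
          using r Vpos mult_right_mono[of 1 "2^k" V] by (simp add: mult.assoc)
        then show ?thesis using r cd V by (simp add: eM eN ennreal_mult[symmetric] ennreal_leI)
      qed
      have "emeasure ?M (U k) \<le> ?l * emeasure ?N (U k)"
      proof (rule emeasure_le_if_on_components[OF U(1)])
        fix J assume J: "J \<in> components (U k)"
        show "emeasure ?M J \<le> ?l * emeasure ?N J"
          by (rule component_dense_intervals_le[OF diffuse_local_measure[OF vm fin] diffuse_local_lborel _ V_le J[unfolded U_def]]) simp
      qed simp_all
      then have 1: "emeasure ?M (U k) \<le> ?l * emeasure lborel (U k)" using U Ub by (simp add: eN)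
      let ?MU = "density ?M (indicator (- U k))"
      have eMU: "emeasure ?MU X = emeasure ?M (- U k \<inter> X)" if "X \<in> sets borel" for X
        using emeasure_restricted[of "- U k" ?M X] that Ub by auto
      have "emeasure ?MU S \<le> ?l * emeasure ?N S"
      proof (rule emeasure_le_if_on_components[OF S(1)])
        fix J assume J: "J \<in> components S"
        obtain p q where pq: "c \<le> p" "p < q" "q \<le> d" "J = {p<..<q}"
          using open_component_interval[OF S(1) J S(2)] by blast
        show "emeasure ?MU J \<le> ?l * emeasure ?N J"
        proof (cases "J \<subseteq> U k")
          case True
          then have "- U k \<inter> J = {}" by auto
          then show ?thesis using eMU[of J] pq by simp
        next
          case False
          then have "J \<notin> dense_intervals ?l ?N ?M c d" unfolding U_def by blast
          then have "\<not> ?l * emeasure ?N J \<le> emeasure ?M J" unfolding dense_intervals_def using pq by blast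
          moreover have "emeasure ?MU J \<le> emeasure ?M J"
            using eMU[of J] pq emeasure_mono[of "- U k \<inter> J" J ?M] by simp
          ultimately show ?thesis by (meson le_cases order_trans)
        qed
      qed simp_all
      then have 2: "emeasure ?M (- U k \<inter> S) \<le> ?l * emeasure lborel S" using S Sb by (simp add: eMU eN)
      have "emeasure ?M S \<le> emeasure ?M (U k \<union> (- U k \<inter> S))" using Ub Sb by (intro emeasure_mono) auto
      also have "\<dots> \<le> emeasure ?M (U k) + emeasure ?M (- U k \<inter> S)"
        using Ub Sb by (intro emeasure_subadditive) auto
      also have "\<dots> \<le> ?l * emeasure lborel (U k) + ?l * emeasure lborel S" using 1 2 by (rule add_mono)
      finally show ?thesis by (simp add: distrib_left)
    qed
    have fw: "(\<integral>\<^sup>+x\<in>{c..d}. Mx x \<partial>lborel) \<le> ennreal (A * V)"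
    proof -
      have "(\<integral>\<^sup>+x\<in>{c..d}. Mx x \<partial>lebesgue) / wmeasure v {c..d} \<le> fujii_wilson_const v"
        unfolding fujii_wilson_const_def Mx_def using cd by (intro SUP_upper2[of "(c, d)"]) auto
      then have "(\<integral>\<^sup>+x\<in>{c..d}. Mx x \<partial>lborel) / ennreal V \<le> ennreal A"
        using A(2) V(1) unfolding wmeasure_def nn_integral_completion set_nn_integral_Icc_eq_Ioo
        by (simp add: mult.commute)
      then have "ennreal V * ((\<integral>\<^sup>+x\<in>{c..d}. Mx x \<partial>lborel) / ennreal V) \<le> ennreal V * ennreal A"
        by (rule mult_left_mono) simp
      also have "ennreal V * ((\<integral>\<^sup>+x\<in>{c..d}. Mx x \<partial>lborel) / ennreal V) = (\<integral>\<^sup>+x\<in>{c..d}. Mx x \<partial>lborel)"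
        using Vpos by (subst mult.commute) (simp only: ennreal_divide_times, simp add: divide_ennreal)
      finally show ?thesis using Vpos A by (simp add: ennreal_mult' mult.commute)
    qed
    \<comment> \<open>The maximal function is not known to be measurable here, so the constant 2 is pulled out of
      the integral of a measurable minorant.\<close>
    define g where "g x = (SUP k\<in>{..<K}. ennreal (2 ^ k * r) * indicator (U k) x)" for x
    have g: "g \<in> borel_measurable borel"
      unfolding g_def using Ub by (intro borel_measurable_SUP) auto
    have g_le: "g x \<le> Mx x * indicator {c..d} x" for x
      unfolding g_def
    proof (rule SUP_least)
      fix k
      show "ennreal (2 ^ k * r) * indicator (U k) x \<le> Mx x * indicator {c..d} x"
        using Mx_ge[of x k] U(2)[of k] by (auto simp: indicator_def)
    qed
    have "(\<Sum>k<K. ennreal (2 ^ k * r) * emeasure lborel (U k))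
        = (\<integral>\<^sup>+x. (\<Sum>k<K. ennreal (2 ^ k * r) * indicator (U k) x) \<partial>lborel)"
      using Ub by (subst nn_integral_sum) (auto simp: nn_integral_cmult_indicator)
    also have "\<dots> \<le> (\<integral>\<^sup>+x. 2 * g x \<partial>lborel)"
    proof (rule nn_integral_mono)
      fix x
      have "(\<Sum>k<K. ennreal (2 ^ k * r) * indicator (U k) x)
          = (\<Sum>k<K. ennreal (2 ^ k * r) * (if x \<in> U k then 1 else 0))"
        by (intro sum.cong) (auto simp: indicator_def)
      also have "\<dots> \<le> 2 * g x"
      proof (rule sum_dyadic_levels_le)
        fix k assume "k < K" "x \<in> U k"
        then show "ennreal (2 ^ k * r) \<le> g x"
          unfolding g_def by (intro SUP_upper2[of k]) auto
      qed (use r in auto)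
      finally show "(\<Sum>k<K. ennreal (2 ^ k * r) * indicator (U k) x) \<le> 2 * g x" .
    qed
    also have "\<dots> = 2 * (\<integral>\<^sup>+x. g x \<partial>lborel)" using g by (intro nn_integral_cmult) simp
    also have "\<dots> \<le> 2 * ennreal (A * V)"
      using nn_integral_mono[of lborel g, OF g_le] fw by (intro mult_left_mono) auto
    finally have 1: "(\<Sum>k<K. ennreal (2 ^ k * r) * emeasure lborel (U k)) \<le> 2 * ennreal (A * V)" .
    have "(\<Sum>k<K. ennreal (2 ^ k * r)) * emeasure lborel S
        \<le> ennreal (2 ^ K * r) * ennreal ((1/2) ^ K * (d - c))"
    proof (intro mult_mono small)
      have "(\<Sum>k<K. ennreal (2 ^ k * r)) = ennreal ((\<Sum>k<K. 2 ^ k) * r)"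
        using r by (subst sum_ennreal) (auto simp: sum_distrib_right)
      also have "(\<Sum>k<K. (2::real) ^ k) = 2 ^ K - 1" by (subst sum_gp_strict) auto
      also have "ennreal ((2 ^ K - 1) * r) \<le> ennreal (2 ^ K * r)"
        using r by (intro ennreal_leI mult_right_mono) auto
      finally show "(\<Sum>k<K. ennreal (2 ^ k * r)) \<le> ennreal (2 ^ K * r)" .
    qed auto
    also have "ennreal (2 ^ K * r) * ennreal ((1/2) ^ K * (d - c)) = ennreal V"
    proof -
      have "(2 ^ K * r) * ((1/2) ^ K * (d - c)) = V" using r(2) by (simp add: power_divide)
      then show ?thesis using r cd by (simp add: ennreal_mult[symmetric])
    qed
    finally have 2: "(\<Sum>k<K. ennreal (2 ^ k * r)) * emeasure lborel S \<le> ennreal V" .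
    have "of_nat K * emeasure ?M S \<le> (\<Sum>k<K. ennreal (2 ^ k * r) * (emeasure lborel (U k) + emeasure lborel S))"
      using sum_mono[of "{..<K}" "\<lambda>_. emeasure ?M S", OF level] by simp
    also have "\<dots> = (\<Sum>k<K. ennreal (2 ^ k * r) * emeasure lborel (U k))
        + (\<Sum>k<K. ennreal (2 ^ k * r)) * emeasure lborel S"
      by (simp add: distrib_left sum.distrib sum_distrib_right)
    also have "\<dots> \<le> 2 * ennreal (A * V) + ennreal V" using 1 2 by (rule add_mono)
    also have "2 * ennreal (A * V) + ennreal V = ennreal (2 * A + 1) * ennreal V"
      using A Vpos by (simp add: ennreal_mult[symmetric] ennreal_plus[symmetric] algebra_simps
          del: ennreal_plus flip: ennreal_numeral)
    finally show ?thesis using S Sb V by (simp add: eM)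
  qed
qed

text \<open>
  The constant makes \<open>K \<ge> 2 * (2 * A + 1)\<close> in the previous estimate; one further factor \<open>1/2\<close> pays
  for replacing a Borel set by an open one.
\<close>
lemma fujii_wilson_halving:
  fixes v :: "real \<Rightarrow> real"
  assumes v: "v \<in> borel_measurable borel" and nonneg: "\<And>t. 0 \<le> v t"
    and fin: "\<And>c d. (\<integral>\<^sup>+t\<in>{c<..<d}. ennreal (v t) \<partial>lborel) < \<infinity>"
    and A: "0 \<le> A" "fujii_wilson_const v \<le> ennreal A"
  shows "halving ((1/2) ^ (nat \<lceil>4 * A\<rceil> + 3)) (\<lambda>t. ennreal (v t))"
  unfolding halving_def
proof (intro allI ballI impI)
  fix c d :: real and S
  define K where "K = nat \<lceil>4 * A\<rceil> + 2"
  assume S: "S \<in> sets borel" "S \<subseteq> {c<..<d}" and cd: "c < d"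
    and small: "emeasure lborel S \<le> ennreal ((1/2) ^ (nat \<lceil>4 * A\<rceil> + 3) * (d - c))"
  have K: "4 * A + 2 \<le> real K" unfolding K_def using A by linarith
  let ?N = "local_measure (\<lambda>_. 1) c d"
  have eN: "emeasure ?N X = emeasure lborel X" if "X \<in> sets borel" "X \<subseteq> {c<..<d}" for X
    using that by (rule emeasure_local_measure_lborel)
  interpret finite_measure ?N using diffuse_local_lborel by (simp add: diffuse_def)
  have "emeasure ?N S < ennreal ((1/2) ^ K * (d - c))"
  proof -
    have "emeasure ?N S \<le> ennreal ((1/2) ^ (nat \<lceil>4 * A\<rceil> + 3) * (d - c))" using S small by (simp add: eN)
    also have "\<dots> < ennreal ((1/2) ^ K * (d - c))" using cd by (intro ennreal_lessI) (auto simp: K_def power_add power3_eq_cube power2_eq_square)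
    finally show ?thesis .
  qed
  moreover have "emeasure ?N S = (INF U \<in> {U. S \<subseteq> U \<and> open U}. emeasure ?N U)"
    using S by (intro outer_regular) (auto simp: emeasure_eq_measure)
  ultimately obtain Q where Q: "S \<subseteq> Q" "open Q" "emeasure ?N Q < ennreal ((1/2) ^ K * (d - c))"
    by (auto simp: INF_less_iff)
  have "emeasure ?N (Q \<inter> {c<..<d}) \<le> emeasure ?N Q" using Q by (intro emeasure_mono) auto
  then have Qsmall: "emeasure lborel (Q \<inter> {c<..<d}) \<le> ennreal ((1/2) ^ K * (d - c))" using Q by (simp add: eN)
  let ?I = "\<integral>\<^sup>+t\<in>{c<..<d}. ennreal (v t) \<partial>lborel" and ?S = "\<integral>\<^sup>+t\<in>S. ennreal (v t) \<partial>lborel"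
  have SI: "?S \<le> ?I" using S by (intro nn_integral_mono) (auto simp: indicator_def)
  have "?S \<le> (\<integral>\<^sup>+t\<in>Q \<inter> {c<..<d}. ennreal (v t) \<partial>lborel)"
    using S Q by (intro nn_integral_mono) (auto simp: indicator_def)
  then have "of_nat K * ?S \<le> of_nat K * (\<integral>\<^sup>+t\<in>Q \<inter> {c<..<d}. ennreal (v t) \<partial>lborel)"
    by (rule mult_left_mono) simp
  also have "\<dots> \<le> ennreal (2 * A + 1) * ?I"
    by (rule fujii_wilson_open[OF v nonneg fin A cd _ _ Qsmall]) (use Q in auto)
  finally have le: "of_nat K * ?S \<le> ennreal (2 * A + 1) * ?I" .
  obtain i where i: "?I = ennreal i" "0 \<le> i" using fin[of c d] by (cases ?I) auto
  obtain s where s: "?S = ennreal s" "0 \<le> s" using SI i by (cases ?S) (auto simp: top_unique)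
  have "real K * s \<le> (2 * A + 1) * i"
  proof -
    have "ennreal (real K * s) \<le> ennreal ((2 * A + 1) * i)"
      using le A i s by (simp add: ennreal_of_nat_eq_real_of_nat ennreal_mult del: ennreal_plus)
    then show ?thesis using A i by (subst (asm) ennreal_le_iff) auto
  qed
  moreover have "(4 * A + 2) * s \<le> real K * s" using K s by (intro mult_right_mono)
  ultimately have "(2 * A + 1) * (2 * s) \<le> (2 * A + 1) * i" by (simp add: algebra_simps)
  then have "2 * s \<le> i" using A by (simp add: mult_le_cancel_left)
  then show "2 * ?S \<le> ?I" using i s by (simp add: ennreal_mult'[symmetric] ennreal_leI flip: ennreal_numeral)
qed

text \<open>
  Rational endpoints make the family countable, so that halos in \<open>n\<close>-dimensional space are
  Borel sets.
\<close>
definition line_halo :: "real \<Rightarrow> real set \<Rightarrow> real set" where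
  "line_halo e F = \<Union>{{p<..<q} |p q. p \<in> \<rat> \<and> q \<in> \<rat> \<and> p < q \<and>
      emeasure lborel ({p<..<q} - F) < ennreal (e * (q - p))}"

text \<open>
  Each interval of the halo has at most the fraction \<open>r\<close> of its weighted mass outside \<open>F\<close>. As \<open>r \<le> 1/2\<close>, that
  part is at most \<open>2 * r\<close> times the part inside \<open>F\<close>, and the covering estimate doubles the factor.
\<close>
lemma line_halo_measure_le:
  fixes v :: "real \<Rightarrow> ennreal"
  assumes v: "v \<in> borel_measurable borel" and fin: "\<And>a b. (\<integral>\<^sup>+t\<in>{a<..<b}. v t \<partial>lborel) < \<infinity>"
    and h: "halving \<eta> v" and eta: "0 < \<eta>" "\<eta> \<le> 1"
    and F: "F \<in> sets borel" and e: "0 < e" "e \<le> 1"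
    and r_def: "r = 2 * e powr (ln (1/2) / ln (\<eta>/2))" and r: "r \<le> 1/2"
  shows "(\<integral>\<^sup>+t\<in>line_halo e F. v t \<partial>lborel) \<le> ennreal (1 + 4 * r) * (\<integral>\<^sup>+t\<in>F. v t \<partial>lborel)"
proof -
  let ?H = "line_halo e F"
  let ?M = "density lborel (\<lambda>t. v t * indicator (- F) t)" and ?N = "density lborel (\<lambda>t. v t * indicator F t)"
  have r0: "0 \<le> r" unfolding r_def by simp
  have eM: "emeasure ?M X = (\<integral>\<^sup>+t\<in>X - F. v t \<partial>lborel)" if "X \<in> sets borel" for X
  proof -
    have "emeasure ?M X = (\<integral>\<^sup>+t. v t * indicator (- F) t * indicator X t \<partial>lborel)"
      using that v F by (subst emeasure_density) auto
    then show ?thesis by (simp add: indicator_def if_distrib cong: if_cong) (auto intro!: nn_integral_cong)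
  qed
  have eN: "emeasure ?N X = (\<integral>\<^sup>+t\<in>X \<inter> F. v t \<partial>lborel)" if "X \<in> sets borel" for X
  proof -
    have "emeasure ?N X = (\<integral>\<^sup>+t. v t * indicator F t * indicator X t \<partial>lborel)"
      using that v F by (subst emeasure_density) auto
    then show ?thesis by (simp add: indicator_def if_distrib cong: if_cong) (auto intro!: nn_integral_cong)
  qed
  have split: "(\<integral>\<^sup>+t\<in>X. v t \<partial>lborel) = emeasure ?M X + emeasure ?N X" if X: "X \<in> sets borel" for X
  proof -
    have "(\<integral>\<^sup>+t\<in>X. v t \<partial>lborel) = (\<integral>\<^sup>+t. v t * indicator (X - F) t + v t * indicator (X \<inter> F) t \<partial>lborel)"
      by (intro nn_integral_cong) (auto simp: indicator_def)
    then show ?thesis using X F v by (simp add: eM eN nn_integral_add)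
  qed
  have oH: "open ?H" unfolding line_halo_def by (intro open_Union) auto
  have "emeasure ?M ?H \<le> 2 * ennreal (2 * r) * emeasure ?N ?H"
    unfolding line_halo_def
  proof (rule emeasure_Union_intervals_le)
    fix J assume "J \<in> {{p<..<q} |p q. p \<in> \<rat> \<and> q \<in> \<rat> \<and> p < q \<and>
      emeasure lborel ({p<..<q} - F) < ennreal (e * (q - p))}"
    then obtain p q where pq: "J = {p<..<q}" "p < q" "emeasure lborel ({p<..<q} - F) < ennreal (e * (q - p))" by auto
    show "\<exists>c d. J = {c<..<d}" using pq by blast
    have J: "J \<in> sets borel" using pq by simp
    have le: "emeasure ?M J \<le> ennreal r * (\<integral>\<^sup>+t\<in>J. v t \<partial>lborel)"
      unfolding eM[OF J] unfolding pq(1) r_def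
      by (rule halving_power_law[OF v fin h eta pq(2) _ _ e]) (use F pq(3) in auto)
    have "emeasure ?M J + emeasure ?N J < \<infinity>" using split[OF J] fin[of p q] pq by simp
    then obtain m n where mn: "emeasure ?M J = ennreal m" "emeasure ?N J = ennreal n" "0 \<le> m" "0 \<le> n"
      by (cases "emeasure ?M J"; cases "emeasure ?N J") auto
    have "ennreal m \<le> ennreal (r * (m + n))"
      using le unfolding split[OF J] mn using mn r0 by (simp add: ennreal_mult ennreal_plus)
    then have "m \<le> r * (m + n)" using mn r0 by (subst (asm) ennreal_le_iff) auto
    moreover have "r * m \<le> 1/2 * m" using r mn by (intro mult_right_mono)
    ultimately have "m \<le> 2 * r * n" by (simp add: algebra_simps)
    then show "emeasure ?M J \<le> ennreal (2 * r) * emeasure ?N J"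
      using mn r0 by (simp add: ennreal_mult[symmetric] ennreal_leI)
  qed auto
  also have "2 * ennreal (2 * r) = ennreal (4 * r)" using r0 by (simp add: ennreal_mult[symmetric] flip: ennreal_numeral)
  finally have MH: "emeasure ?M ?H \<le> ennreal (4 * r) * emeasure ?N ?H" .
  have NH: "emeasure ?N ?H \<le> (\<integral>\<^sup>+t\<in>F. v t \<partial>lborel)"
    using oH by (simp add: eN) (auto intro!: nn_integral_mono simp: indicator_def)
  have "(\<integral>\<^sup>+t\<in>?H. v t \<partial>lborel) \<le> ennreal (4 * r) * emeasure ?N ?H + emeasure ?N ?H"
    using split[of ?H] oH MH by (simp add: add_right_mono)
  also have "\<dots> = ennreal (1 + 4 * r) * emeasure ?N ?H"
    using r0 by (simp add: ennreal_plus distrib_right add.commute)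
  also have "\<dots> \<le> ennreal (1 + 4 * r) * (\<integral>\<^sup>+t\<in>F. v t \<partial>lborel)" using NH by (rule mult_left_mono) simp
  finally show ?thesis .
qed

section \<open>Coordinate lines and iterated integrals\<close>

definition upd :: "real^'n \<Rightarrow> 'n \<Rightarrow> real \<Rightarrow> real^'n" where
  "upd x j t = (\<chi> i. if i = j then t else x $ i)"

lemma upd_nth [simp]: "upd x j t $ i = (if i = j then t else x $ i)"
  by (simp add: upd_def)

lemma upd_upd [simp]: "upd (upd x j s) j t = upd x j t"
  by (simp add: vec_eq_iff)

lemma upd_commute: "i \<noteq> j \<Longrightarrow> upd (upd x i s) j t = upd (upd x j t) i s"
  by (auto simp: vec_eq_iff)

lemma measurable_upd_pair [measurable]:
  fixes j :: "'n::finite"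
  shows "(\<lambda>(x, t). upd x j t) \<in> borel \<Otimes>\<^sub>M borel \<rightarrow>\<^sub>M borel"
proof -
  have "continuous_on UNIV (\<lambda>p. upd (fst p) j (snd p) :: real^'n)"
    unfolding upd_def
  proof (intro continuous_on_vec_lambda)
    fix i show "continuous_on UNIV (\<lambda>p. if i = j then snd p else fst p $ i)"
      by (cases "i = j") (auto intro!: continuous_intros)
  qed
  then have "(\<lambda>p. upd (fst p) j (snd p) :: real^'n) \<in> borel \<rightarrow>\<^sub>M borel"
    by (rule borel_measurable_continuous_onI)
  then show ?thesis by (simp add: borel_prod case_prod_beta')
qed

lemma measurable_upd [measurable (raw)]:
  assumes "f \<in> M \<rightarrow>\<^sub>M borel" "g \<in> M \<rightarrow>\<^sub>M borel"
  shows "(\<lambda>z. upd (f z) j (g z)) \<in> M \<rightarrow>\<^sub>M (borel :: (real^'n) measure)"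
  using measurable_compose[OF measurable_Pair[OF assms] measurable_upd_pair[of j]] by simp

text \<open>
  Integration over the coordinates in a list only, with the others frozen at their values in \<open>x\<close>. This
  allows induction on the number of coordinates within the fixed space \<open>real^'n\<close>.
\<close>
primrec iter_int :: "('n \<Rightarrow> real set) \<Rightarrow> 'n list \<Rightarrow> (real^'n \<Rightarrow> ennreal) \<Rightarrow> real^'n \<Rightarrow> ennreal" where
  "iter_int S [] f = f"
| "iter_int S (j # js) f = (\<lambda>x. \<integral>\<^sup>+t\<in>S j. iter_int S js f (upd x j t) \<partial>lborel)"

lemma borel_measurable_line_integral:
  assumes [measurable]: "f \<in> borel_measurable borel" "A \<in> sets borel"
  shows "(\<lambda>x::real^'n. \<integral>\<^sup>+t\<in>A. f (upd x j t) \<partial>lborel) \<in> borel_measurable borel"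
  by measurable

lemma borel_measurable_iter_int:
  assumes "f \<in> borel_measurable borel" "\<And>j. S j \<in> sets borel"
  shows "iter_int S js f \<in> borel_measurable borel"
  using assms by (induction js) (auto intro!: borel_measurable_line_integral)

primrec iter_ae :: "'n list \<Rightarrow> (real^'n \<Rightarrow> bool) \<Rightarrow> real^'n \<Rightarrow> bool" where
  "iter_ae [] P = P"
| "iter_ae (j # js) P = (\<lambda>x. AE t in lborel. iter_ae js P (upd x j t))"

lemma iter_ae_mono: "iter_ae js P x \<Longrightarrow> (\<And>y. P y \<Longrightarrow> Q y) \<Longrightarrow> iter_ae js Q x"
proof (induction js arbitrary: x)
  case (Cons j js)
  then have "AE t in lborel. iter_ae js P (upd x j t)" by simp
  then have "AE t in lborel. iter_ae js Q (upd x j t)" using Cons.IH Cons.prems(2) by (auto elim: eventually_mono)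
  then show ?case by simp
qed auto

lemma iter_ae_if_iter_int_0:
  assumes f: "f \<in> borel_measurable borel"
  shows "iter_int (\<lambda>_. UNIV) js f x = 0 \<Longrightarrow> iter_ae js (\<lambda>x. f x = 0) x"
proof (induction js arbitrary: x)
  case (Cons j js)
  have [measurable]: "iter_int (\<lambda>_. UNIV) js f \<in> borel_measurable borel"
    using f by (intro borel_measurable_iter_int) auto
  have "(\<integral>\<^sup>+t. iter_int (\<lambda>_. UNIV) js f (upd x j t) \<partial>lborel) = 0" using Cons.prems by simp
  then have "AE t in lborel. iter_int (\<lambda>_. UNIV) js f (upd x j t) = 0"
    by (subst (asm) nn_integral_0_iff_AE) auto
  then show ?case using Cons.IH by (auto elim: eventually_mono)
qed simp

text \<open>
  The inequality is linear in \<open>f\<close>, so Tonelli's theorem carries it from the lines in direction \<open>j\<close> to the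
  integral over the other coordinates.
\<close>
lemma iter_int_average_le:
  assumes f[measurable]: "f \<in> borel_measurable borel" and S[measurable]: "\<And>j. S j \<in> sets borel"
    and [measurable]: "A \<in> sets borel" "B \<in> sets borel"
    and j: "j \<notin> set js"
    and "iter_ae js (\<lambda>y. 2 * (\<integral>\<^sup>+t\<in>A. f (upd y j t) \<partial>lborel) \<le> (\<integral>\<^sup>+t\<in>B. f (upd y j t) \<partial>lborel)) x"
  shows "2 * (\<integral>\<^sup>+t\<in>A. iter_int S js f (upd x j t) \<partial>lborel) \<le> (\<integral>\<^sup>+t\<in>B. iter_int S js f (upd x j t) \<partial>lborel)"
  using j assms(6)
proof (induction js arbitrary: x)
  case (Cons i js)
  have ij: "i \<noteq> j" "j \<notin> set js" using Cons.prems(1) by auto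
  have [measurable]: "iter_int S js f \<in> borel_measurable borel"
    using f S by (rule borel_measurable_iter_int)
  have swap: "(\<integral>\<^sup>+t\<in>C. iter_int S (i # js) f (upd x j t) \<partial>lborel)
      = (\<integral>\<^sup>+s\<in>S i. (\<integral>\<^sup>+t\<in>C. iter_int S js f (upd (upd x i s) j t) \<partial>lborel) \<partial>lborel)"
    if [measurable]: "C \<in> sets borel" for C
  proof -
    have "(\<integral>\<^sup>+t\<in>C. iter_int S (i # js) f (upd x j t) \<partial>lborel)
        = (\<integral>\<^sup>+t. (\<integral>\<^sup>+s. iter_int S js f (upd (upd x i s) j t) * indicator (S i) s * indicator C t \<partial>lborel) \<partial>lborel)"
      using ij(1) by (simp add: nn_integral_multc[symmetric] upd_commute[of j i])
    also have "\<dots> = (\<integral>\<^sup>+s. (\<integral>\<^sup>+t. iter_int S js f (upd (upd x i s) j t) * indicator (S i) s * indicator C t \<partial>lborel) \<partial>lborel)"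
      by (rule lborel_pair.Fubini') measurable
    also have "\<dots> = (\<integral>\<^sup>+s\<in>S i. (\<integral>\<^sup>+t\<in>C. iter_int S js f (upd (upd x i s) j t) \<partial>lborel) \<partial>lborel)"
    proof (rule nn_integral_cong)
      fix s
      have "(\<integral>\<^sup>+t. iter_int S js f (upd (upd x i s) j t) * indicator (S i) s * indicator C t \<partial>lborel)
          = (\<integral>\<^sup>+t. (iter_int S js f (upd (upd x i s) j t) * indicator C t) * indicator (S i) s \<partial>lborel)"
        by (simp only: mult_ac)
      also have "\<dots> = (\<integral>\<^sup>+t\<in>C. iter_int S js f (upd (upd x i s) j t) \<partial>lborel) * indicator (S i) s"
        by (rule nn_integral_multc) measurable
      finally show "(\<integral>\<^sup>+t. iter_int S js f (upd (upd x i s) j t) * indicator (S i) s * indicator C t \<partial>lborel)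
          = (\<integral>\<^sup>+t\<in>C. iter_int S js f (upd (upd x i s) j t) \<partial>lborel) * indicator (S i) s" .
    qed
    finally show ?thesis .
  qed
  have ae: "AE s in lborel. 2 * (\<integral>\<^sup>+t\<in>A. iter_int S js f (upd (upd x i s) j t) \<partial>lborel)
      \<le> (\<integral>\<^sup>+t\<in>B. iter_int S js f (upd (upd x i s) j t) \<partial>lborel)"
    using Cons.prems(2) Cons.IH[OF ij(2)] by (auto elim: eventually_mono)
  have "2 * (\<integral>\<^sup>+s\<in>S i. (\<integral>\<^sup>+t\<in>A. iter_int S js f (upd (upd x i s) j t) \<partial>lborel) \<partial>lborel)
      = (\<integral>\<^sup>+s. 2 * ((\<integral>\<^sup>+t\<in>A. iter_int S js f (upd (upd x i s) j t) \<partial>lborel) * indicator (S i) s) \<partial>lborel)"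
    by (rule nn_integral_cmult[symmetric]) measurable
  also have "\<dots> \<le> (\<integral>\<^sup>+s\<in>S i. (\<integral>\<^sup>+t\<in>B. iter_int S js f (upd (upd x i s) j t) \<partial>lborel) \<partial>lborel)"
    using ae by (intro nn_integral_mono_AE) (auto elim!: eventually_mono simp: indicator_def)
  finally show ?case by (simp only: swap assms)
qed simp

lemma iter_int_halving:
  assumes f: "f \<in> borel_measurable borel" and S: "\<And>j. S j \<in> sets borel" and j: "j \<notin> set js"
    and ae: "iter_ae js (\<lambda>y. halving \<eta> (\<lambda>t. f (upd y j t))) x"
  shows "halving \<eta> (\<lambda>t. iter_int S js f (upd x j t))"
  unfolding halving_def
proof (intro allI ballI impI)
  fix c d :: real and T
  assume T: "T \<in> sets borel" "T \<subseteq> {c<..<d}" "c < d" "emeasure lborel T \<le> ennreal (\<eta> * (d - c))"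
  show "2 * (\<integral>\<^sup>+t\<in>T. iter_int S js f (upd x j t) \<partial>lborel) \<le> (\<integral>\<^sup>+t\<in>{c<..<d}. iter_int S js f (upd x j t) \<partial>lborel)"
    by (rule iter_int_average_le[OF f S T(1) _ j]) 
      (use T in \<open>auto intro!: iter_ae_mono[OF ae] halvingD\<close>)
qed

interpretation lborel_prod: product_sigma_finite "\<lambda>_. lborel :: real measure"
  by standard

lemma measurable_vec_lambda_PiM:
  assumes "\<And>i. (\<lambda>z. f z i) \<in> borel_measurable M"
  shows "(\<lambda>z. (\<chi> i. f z i) :: real^'n) \<in> M \<rightarrow>\<^sub>M borel"
  using assms by (subst borel_measurable_euclidean_space) (auto simp: Basis_vec_def inner_axis)

lemma measurable_component_PiM_lborel:
  "i \<in> I \<Longrightarrow> (\<lambda>z. z i) \<in> borel_measurable (Pi\<^sub>M I (\<lambda>_. lborel :: real measure))"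
  using measurable_component_singleton[of i I "\<lambda>_. lborel :: real measure"] by simp

lemma measurable_vec_lambda: "vec_lambda \<in> Pi\<^sub>M UNIV (\<lambda>_. lborel) \<rightarrow>\<^sub>M (borel :: (real^'n) measure)"
  using measurable_vec_lambda_PiM[of "\<lambda>z i. z i" "Pi\<^sub>M UNIV (\<lambda>_. lborel)", OF measurable_component_PiM_lborel]
  by simp

lemma borel_measurable_vec_nth: "(\<lambda>x::real^'n. x $ i) \<in> borel_measurable borel"
  by (intro borel_measurable_continuous_onI continuous_intros)

lemma lborel_vec_eq:
  "(lborel :: (real^'n) measure) = distr (Pi\<^sub>M UNIV (\<lambda>_. lborel)) borel vec_lambda"
proof (rule lborel_eqI)
  note m = measurable_vec_lambda[where 'n = 'n]
  fix l u :: "real^'n" assume lu: "\<And>b. b \<in> Basis \<Longrightarrow> l \<bullet> b \<le> u \<bullet> b"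
  then have le: "l $ i \<le> u $ i" for i
    by (metis axis_in_Basis_iff cart_eq_inner_axis inner_commute real_inner_1_right insertI1 Basis_real_def)
  have "vec_lambda -` box l u \<inter> space (Pi\<^sub>M UNIV (\<lambda>_. lborel)) = Pi\<^sub>E UNIV (\<lambda>i. {l $ i<..<u $ i})"
    by (auto simp: mem_box_cart space_PiM PiE_def Pi_iff)
  then have "emeasure (distr (Pi\<^sub>M UNIV (\<lambda>_. lborel)) borel vec_lambda) (box l u)
      = (\<Prod>i\<in>UNIV. emeasure lborel {l $ i<..<u $ i})"
    using m by (simp add: emeasure_distr lborel_prod.emeasure_PiM)
  also have "\<dots> = ennreal (\<Prod>i\<in>UNIV. u $ i - l $ i)"
    using le by (simp add: prod_ennreal)
  also have "(\<Prod>i\<in>UNIV. u $ i - l $ i) = (\<Prod>b\<in>Basis. (u - l) \<bullet> b)"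
  proof -
    have inj: "inj (\<lambda>i::'n. axis i (1::real))" by (auto simp: inj_on_def axis_eq_axis)
    have B: "(Basis :: (real^'n) set) = (\<lambda>i. axis i 1) ` UNIV" by (auto simp: Basis_vec_def)
    show ?thesis unfolding B using inj by (subst prod.reindex) (auto simp: inner_axis)
  qed
  finally show "emeasure (distr (Pi\<^sub>M UNIV (\<lambda>_. lborel)) borel vec_lambda) (box l u) = ennreal (\<Prod>b\<in>Basis. (u - l) \<bullet> b)" .
qed simp

lemma nn_integral_lborel_vec:
  assumes f: "f \<in> borel_measurable (borel :: (real^'n) measure)"
  shows "(\<integral>\<^sup>+x. f x \<partial>lborel) = (\<integral>\<^sup>+z. f (vec_lambda z) \<partial>Pi\<^sub>M UNIV (\<lambda>_. lborel))"
  unfolding lborel_vec_eq 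
  using measurable_vec_lambda f by (subst nn_integral_distr) auto

lemma nn_integral_lborel_line:
  assumes f: "f \<in> borel_measurable (borel :: (real^'n) measure)"
  shows "(\<integral>\<^sup>+x. f x \<partial>lborel) =
    (\<integral>\<^sup>+y. (\<integral>\<^sup>+t. f (upd (vec_lambda y) j t) \<partial>lborel) \<partial>Pi\<^sub>M (UNIV - {j}) (\<lambda>_. lborel))"
proof -
  have m: "(\<lambda>z. f (vec_lambda z)) \<in> borel_measurable (Pi\<^sub>M (insert j (UNIV - {j})) (\<lambda>_. lborel))"
    by (rule measurable_compose[OF measurable_vec_lambda_PiM f]) (simp add: measurable_component_PiM_lborel)
  have i: "insert j (UNIV - {j}) = UNIV" by auto
  have e: "vec_lambda (z(j := t)) = upd (vec_lambda z) j t" for z :: "'n \<Rightarrow> real" and t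
    by (simp add: vec_eq_iff)
  show ?thesis
    unfolding nn_integral_lborel_vec[OF f]
    using lborel_prod.product_nn_integral_insert[OF _ _ m] by (simp add: i e)
qed

text \<open>
  The lines violating \<open>Q\<close> need not form a measurable set, but a measurable null set of lines contains
  them, and by Fubini its lines sweep out a null set of points.
\<close>
lemma AE_lborel_if_AE_lines:
  assumes "AE y in Pi\<^sub>M (UNIV - {j}) (\<lambda>_. lborel). Q (\<lambda>t. upd (vec_lambda y) j t)"
  shows "AE x in (lborel :: (real^'n) measure). Q (\<lambda>t. upd x j t)"
proof -
  let ?P = "Pi\<^sub>M (UNIV - {j}) (\<lambda>_::'n. lborel :: real measure)"
  obtain N where N: "N \<in> null_sets ?P" "{y \<in> space ?P. \<not> Q (\<lambda>t. upd (vec_lambda y) j t)} \<subseteq> N"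
    using assms by (auto simp: eventually_ae_filter)
  define rs where "rs x = restrict (\<lambda>i. x $ i) (UNIV - {j})" for x :: "real^'n"
  have rs[measurable]: "rs \<in> borel \<rightarrow>\<^sub>M ?P" unfolding rs_def by (intro measurable_restrict) simp
  have Nm: "N \<in> sets ?P" using N by auto
  have m: "(\<lambda>x. indicator N (rs x) :: ennreal) \<in> borel_measurable borel"
    using measurable_compose[OF rs borel_measurable_indicator[OF Nm]] .
  have "(\<integral>\<^sup>+x. indicator N (rs x) \<partial>lborel) = (\<integral>\<^sup>+y. (\<integral>\<^sup>+t. indicator N y \<partial>(lborel :: real measure)) \<partial>?P)"
  proof -
    have "rs (upd (vec_lambda y) j t) = y" if "y \<in> space ?P" for y t
      using that by (auto simp: rs_def space_PiM PiE_def extensional_def fun_eq_iff)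
    then show ?thesis unfolding nn_integral_lborel_line[OF m, of j] by (intro nn_integral_cong) simp
  qed
  also have "(\<integral>\<^sup>+y. (\<integral>\<^sup>+t. indicator N y \<partial>(lborel :: real measure)) \<partial>?P) = 0"
    using Nm N(1) by (subst nn_integral_0_iff_AE) (auto simp: indicator_def intro!: AE_I'[OF N(1)])
  finally have "AE x in lborel. indicator N (rs x) = (0::ennreal)"
    using m by (subst (asm) nn_integral_0_iff_AE) auto
  then show ?thesis
  proof (rule eventually_mono)
    fix x :: "real^'n" assume "indicator N (rs x) = (0::ennreal)"
    then have "rs x \<notin> N" by (simp add: indicator_def split: if_splits)
    moreover have "rs x \<in> space ?P" by (simp add: rs_def space_PiM)
    moreover have "upd (vec_lambda (rs x)) j = upd x j" by (auto simp: fun_eq_iff vec_eq_iff rs_def)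
    ultimately show "Q (\<lambda>t. upd x j t)" using N(2) by force
  qed
qed

lemma measurable_upd_vec_lambda:
  "(\<lambda>(y, t). upd (vec_lambda y) j t :: real^'n) \<in> Pi\<^sub>M (UNIV - {j}) (\<lambda>_. lborel) \<Otimes>\<^sub>M borel \<rightarrow>\<^sub>M borel"
  unfolding upd_def case_prod_beta'
proof (rule measurable_vec_lambda_PiM)
  fix i :: 'n
  show "(\<lambda>z. if i = j then snd z else vec_lambda (fst z) $ i)
      \<in> borel_measurable (Pi\<^sub>M (UNIV - {j}) (\<lambda>_. lborel) \<Otimes>\<^sub>M borel)"
    by (cases "i = j") (auto intro!: measurable_compose[OF measurable_fst])
qed

lemma AE_lines_if_AE_lborel:
  assumes "AE x in (lborel :: (real^'n) measure). P x"
  shows "AE y in Pi\<^sub>M (UNIV - {j}) (\<lambda>_. lborel). AE t in lborel. P (upd (vec_lambda y) j t)"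
proof -
  let ?P = "Pi\<^sub>M (UNIV - {j}) (\<lambda>_::'n. lborel :: real measure)"
  obtain N where N: "N \<in> null_sets lborel" "{x. \<not> P x} \<subseteq> N"
    using assms by (auto simp: eventually_ae_filter)
  have Nb[measurable]: "N \<in> sets borel" using N by auto
  note m1 = measurable_upd_vec_lambda[of j]
  then have m2: "(\<lambda>(y, t). indicator N (upd (vec_lambda y) j t) :: ennreal) \<in> borel_measurable (?P \<Otimes>\<^sub>M lborel)"
    by (simp add: case_prod_beta' measurable_lborel2 cong: measurable_cong_sets) 
  have m3: "(\<lambda>y. \<integral>\<^sup>+t. indicator N (upd (vec_lambda y) j t) \<partial>lborel) \<in> borel_measurable ?P"
    using lborel.borel_measurable_nn_integral[OF m2] by simp
  have "(\<integral>\<^sup>+y. (\<integral>\<^sup>+t. indicator N (upd (vec_lambda y) j t) \<partial>lborel) \<partial>?P) = (\<integral>\<^sup>+x. indicator N x \<partial>lborel)"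
    using nn_integral_lborel_line[of "indicator N" j] by simp
  also have "\<dots> = 0" using N by (simp add: null_sets_def)
  finally have "AE y in ?P. (\<integral>\<^sup>+t. indicator N (upd (vec_lambda y) j t) \<partial>lborel) = 0"
    using m3 by (subst (asm) nn_integral_0_iff_AE) auto
  then show ?thesis
  proof (rule eventually_mono)
    fix y assume "(\<integral>\<^sup>+t. indicator N (upd (vec_lambda y) j t) \<partial>lborel) = 0"
    then have "AE t in lborel. indicator N (upd (vec_lambda y) j t) = (0::ennreal)"
      by (subst (asm) nn_integral_0_iff_AE) auto
    then show "AE t in lborel. P (upd (vec_lambda y) j t)"
      by (rule eventually_mono) (use N(2) in \<open>auto simp: indicator_def split: if_splits\<close>)
  qed
qed

text \<open>
  Ties the iterated integral to the product measure; the indicator factors account for the domains of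
  integration.
\<close>
lemma iter_int_eq_PiM:
  fixes x :: "real^'n"
  assumes f: "f \<in> borel_measurable borel" and S: "\<And>j. S j \<in> sets borel" and d: "distinct js"
  shows "iter_int S js f x = (\<integral>\<^sup>+z. f (\<chi> i. if i \<in> set js then z i else x $ i) * (\<Prod>i\<in>set js. indicator (S i) (z i))
     \<partial>Pi\<^sub>M (set js) (\<lambda>_. lborel))"
  using d
proof (induction js arbitrary: x)
  case Nil
  then show ?case by (simp add: PiM_empty nn_integral_count_space_finite)
next
  case (Cons j js)
  let ?F = "\<lambda>x J z. f (\<chi> i. if i \<in> J then z i else x $ i) * (\<Prod>i\<in>J. indicator (S i) (z i))"
  have m: "?F x J \<in> borel_measurable (Pi\<^sub>M J (\<lambda>_. lborel))" for x J
  proof (intro borel_measurable_times_ennreal borel_measurable_prod_ennreal)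
    show "(\<lambda>z. f (\<chi> i. if i \<in> J then z i else x $ i)) \<in> borel_measurable (Pi\<^sub>M J (\<lambda>_. lborel))"
    proof (rule measurable_compose[OF measurable_vec_lambda_PiM f])
      fix i show "(\<lambda>z. if i \<in> J then z i else x $ i) \<in> borel_measurable (Pi\<^sub>M J (\<lambda>_. lborel))"
        by (cases "i \<in> J") auto
    qed
    fix i assume "i \<in> J"
    then show "(\<lambda>z. indicator (S i) (z i) :: ennreal) \<in> borel_measurable (Pi\<^sub>M J (\<lambda>_. lborel))"
      using S by (intro measurable_compose[OF measurable_component_singleton borel_measurable_indicator]) auto
  qed
  have j: "j \<notin> set js" using Cons.prems by simp
  have "(\<integral>\<^sup>+z. ?F x (set (j # js)) z \<partial>Pi\<^sub>M (set (j # js)) (\<lambda>_. lborel))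
     = (\<integral>\<^sup>+t. (\<integral>\<^sup>+z. ?F x (insert j (set js)) (z(j := t)) \<partial>Pi\<^sub>M (set js) (\<lambda>_. lborel)) \<partial>lborel)"
    using lborel_prod.product_nn_integral_insert_rev[OF _ j m[where x = x and J = "insert j (set js)"]] by simp
  also have "\<dots> = (\<integral>\<^sup>+t. (\<integral>\<^sup>+z. ?F (upd x j t) (set js) z * indicator (S j) t \<partial>Pi\<^sub>M (set js) (\<lambda>_. lborel)) \<partial>lborel)"
  proof (intro nn_integral_cong)
    fix t z
    have "(\<chi> i. if i \<in> insert j (set js) then (z(j := t)) i else x $ i) = ((\<chi> i. if i \<in> set js then z i else upd x j t $ i) :: real^'n)"
      using j by (auto simp: vec_eq_iff)
    moreover have "(\<Prod>i\<in>insert j (set js). indicator (S i) ((z(j := t)) i)) = (indicator (S j) t * (\<Prod>i\<in>set js. indicator (S i) (z i)) :: ennreal)"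
    proof -
      have "(\<Prod>i\<in>set js. indicator (S i) ((z(j := t)) i)) = (\<Prod>i\<in>set js. indicator (S i) (z i) :: ennreal)"
        using j by (intro prod.cong) auto
      then show ?thesis using j by simp
    qed
    ultimately show "?F x (insert j (set js)) (z(j := t)) = ?F (upd x j t) (set js) z * indicator (S j) t"
      by (simp only: mult_ac)
  qed
  also have "\<dots> = (\<integral>\<^sup>+t. (\<integral>\<^sup>+z. ?F (upd x j t) (set js) z \<partial>Pi\<^sub>M (set js) (\<lambda>_. lborel)) * indicator (S j) t \<partial>lborel)"
    using m by (intro nn_integral_cong nn_integral_multc)
  also have "\<dots> = iter_int S (j # js) f x" using Cons by simp
  finally show ?case by simp
qed

lemma iter_int_full:
  assumes f: "f \<in> borel_measurable borel" and S: "\<And>j. S j \<in> sets borel"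
    and js: "distinct js" "set js = (UNIV :: 'n::finite set)"
  shows "iter_int S js f x = (\<integral>\<^sup>+x. f x * (\<Prod>i\<in>UNIV. indicator (S i) (x $ i)) \<partial>lborel)"
proof -
  have "(\<lambda>x. f x * (\<Prod>i\<in>UNIV. indicator (S i) (x $ i))) \<in> borel_measurable (borel :: (real^'n) measure)"
    using f S by (intro borel_measurable_times_ennreal borel_measurable_prod_ennreal
        measurable_compose[OF borel_measurable_vec_nth borel_measurable_indicator]) simp_all
  from nn_integral_lborel_vec[OF this] show ?thesis
    unfolding iter_int_eq_PiM[OF f S js(1)] js(2) by simp
qed

lemma iter_ae_full:
  assumes "AE x in lborel. P x" and js: "distinct js" "set js = (UNIV :: 'n::finite set)"
  shows "iter_ae js P x"
proof -
  obtain N where N: "N \<in> null_sets lborel" "{x. \<not> P x} \<subseteq> N"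
    using assms by (auto simp: eventually_ae_filter)
  have Nb: "indicator N \<in> borel_measurable (borel :: (real^'n) measure)" using N by auto
  have "iter_int (\<lambda>_. UNIV) js (indicator N) x = (\<integral>\<^sup>+x. indicator N x \<partial>lborel)"
    using iter_int_full[OF Nb _ js, of "\<lambda>_. UNIV"] by simp
  also have "\<dots> = 0" using N by (simp add: null_sets_def)
  finally have "iter_ae js (\<lambda>x. indicator N x = (0::ennreal)) x" by (rule iter_ae_if_iter_int_0[OF Nb])
  then show ?thesis by (rule iter_ae_mono) (use N(2) in \<open>auto simp: indicator_def split: if_splits\<close>)
qed

section \<open>Halos in coordinate directions\<close>

definition halo :: "real \<Rightarrow> 'n \<Rightarrow> (real^'n) set \<Rightarrow> (real^'n) set" where
  "halo e j F = {x. x $ j \<in> line_halo e {t. upd x j t \<in> F}}"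

primrec iter_halo :: "real \<Rightarrow> 'n list \<Rightarrow> (real^'n) set \<Rightarrow> (real^'n) set" where
  "iter_halo e [] F = F"
| "iter_halo e (j # js) F = halo e j (iter_halo e js F)"

lemma mem_line_halo_iff:
  "t \<in> line_halo e F \<longleftrightarrow> (\<exists>p\<in>\<rat>. \<exists>q\<in>\<rat>. p < t \<and> t < q \<and>
      emeasure lborel ({p<..<q} - F) < ennreal (e * (q - p)))" (is "?L \<longleftrightarrow> ?R")
proof
  assume ?L
  then obtain p q where "p \<in> \<rat>" "q \<in> \<rat>" "t \<in> {p<..<q}"
    "emeasure lborel ({p<..<q} - F) < ennreal (e * (q - p))" unfolding line_halo_def by blast
  then show ?R by (intro bexI[of _ p] bexI[of _ q] conjI) simp_all
next
  assume ?R
  then obtain p q where pq: "p \<in> \<rat>" "q \<in> \<rat>" "p < t" "t < q"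
    "emeasure lborel ({p<..<q} - F) < ennreal (e * (q - p))" by blast
  then have "p < q" "t \<in> {p<..<q}" by auto
  then show ?L unfolding line_halo_def using pq by blast
qed

lemma vimage_upd_borel: "F \<in> sets borel \<Longrightarrow> {t. upd x j t \<in> F} \<in> sets borel"
  using measurable_sets[OF measurable_upd[of "\<lambda>_. x" borel "\<lambda>t. t" j], of F] by (simp add: vimage_def)

lemma emeasure_line_complement:
  assumes "F \<in> sets borel"
  shows "emeasure lborel ({p<..<q} - {t. upd x j t \<in> F}) = (\<integral>\<^sup>+t\<in>{p<..<q}. indicator (- F) (upd x j t) \<partial>lborel)"
proof -
  have "{p<..<q} - {t. upd x j t \<in> F} \<in> sets lborel" using vimage_upd_borel[OF assms, of x j] by simp
  from nn_integral_indicator[OF this, symmetric] show ?thesis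
    by (simp only:) (intro nn_integral_cong, auto simp: indicator_def)
qed

lemma sets_halo:
  assumes F: "F \<in> sets borel"
  shows "halo e j F \<in> sets borel"
proof -
  let ?m = "\<lambda>p q x. \<integral>\<^sup>+t\<in>{p<..<q}. indicator (- F) (upd x j t) \<partial>lborel"
  let ?A = "\<lambda>p q. {x. p < x $ j \<and> x $ j < q \<and> ?m p q x < ennreal (e * (q - p))}"
  have eq: "halo e j F = (\<Union>p\<in>\<rat>. \<Union>q\<in>\<rat>. ?A p q)"
    unfolding halo_def mem_line_halo_iff emeasure_line_complement[OF F, symmetric] by auto
  have A: "?A p q \<in> sets borel" for p q
  proof -
    have [measurable]: "?m p q \<in> borel_measurable borel"
      using F by (intro borel_measurable_line_integral) auto
    note borel_measurable_vec_nth[measurable]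
    show ?thesis by measurable
  qed
  show ?thesis unfolding eq by (intro sets.countable_UN'' countable_rat A)
qed

lemma sets_iter_halo: "F \<in> sets borel \<Longrightarrow> iter_halo e js F \<in> sets borel"
  by (induction js) (auto intro: sets_halo)

text \<open>
  A closed interval with real endpoints may replace the open rational one, because the inequality is
  strict: it survives a small enlargement of the interval.
\<close>
lemma mem_haloI:
  assumes F: "F \<in> sets borel" and ab: "a < b" and x: "a \<le> x $ j" "x $ j \<le> b"
    and m: "emeasure lborel ({a<..<b} - {t. upd x j t \<in> F}) < ennreal (e * (b - a))"
  shows "x \<in> halo e j F"
proof -
  let ?G = "{t. upd x j t \<in> F}"
  have G: "?G \<in> sets borel" by (rule vimage_upd_borel[OF F])
  obtain m where m': "emeasure lborel ({a<..<b} - ?G) = ennreal m" "0 \<le> m"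
    using m by (cases "emeasure lborel ({a<..<b} - ?G)") auto
  have lt: "m < e * (b - a)" using m m' by (simp add: ennreal_less_iff)
  \<comment> \<open>Two added pieces of length below \<open>s\<close> use up half of the slack \<open>e * (b - a) - m\<close>.\<close>
  define s where "s = (e * (b - a) - m) / 4"
  have s: "0 < s" "m + 2 * s < e * (b - a)" using lt by (auto simp: s_def field_simps)
  have e: "0 < e" using lt m'(2) ab by (meson diff_gt_0_iff_gt le_less_trans zero_less_mult_pos2)
  obtain p where p: "p \<in> \<rat>" "a - s < p" "p < a" using Rats_dense_in_real[of "a - s" a] s by auto
  obtain q where q: "q \<in> \<rat>" "b < q" "q < b + s" using Rats_dense_in_real[of b "b + s"] s by auto
  have "emeasure lborel ({p<..<q} - ?G) \<le> emeasure lborel (({a<..<b} - ?G) \<union> ({p..a} \<union> {b..q}))"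
    using G by (intro emeasure_mono) auto
  also have "\<dots> \<le> emeasure lborel ({a<..<b} - ?G) + (emeasure lborel {p..a} + emeasure lborel {b..q})"
    using G by (intro order_trans[OF emeasure_subadditive] add_left_mono emeasure_subadditive) auto
  also have "\<dots> = ennreal (m + ((a - p) + (q - b)))"
    using m' p q by (simp add: ennreal_plus)
  also have "\<dots> < ennreal (e * (q - p))"
  proof (intro ennreal_lessI)
    have "e * (b - a) \<le> e * (q - p)" using e p q by (intro mult_left_mono) auto
    then show "m + ((a - p) + (q - b)) < e * (q - p)" using s p q by linarith
    show "0 < e * (q - p)" using e p q ab by (intro mult_pos_pos) auto
  qed
  finally have "emeasure lborel ({p<..<q} - ?G) < ennreal (e * (q - p))" .
  then show ?thesis
    unfolding halo_def mem_line_halo_iff mem_Collect_eq using p q x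
    by (intro bexI[of _ p] bexI[of _ q] conjI) simp_all
qed

lemma halo_measure_le:
  fixes w :: "real^'n \<Rightarrow> ennreal"
  assumes w: "w \<in> borel_measurable borel"
    and good: "AE y in Pi\<^sub>M (UNIV - {j}) (\<lambda>_. lborel). halving \<eta> (\<lambda>t. w (upd (vec_lambda y) j t)) \<and>
        (\<forall>a b. (\<integral>\<^sup>+t\<in>{a<..<b}. w (upd (vec_lambda y) j t) \<partial>lborel) < \<infinity>)"
    and eta: "0 < \<eta>" "\<eta> \<le> 1" and F: "F \<in> sets borel" and e: "0 < e" "e \<le> 1"
    and r_def: "r = 2 * e powr (ln (1/2) / ln (\<eta>/2))" and r: "r \<le> 1/2"
  shows "(\<integral>\<^sup>+x\<in>halo e j F. w x \<partial>lborel) \<le> ennreal (1 + 4 * r) * (\<integral>\<^sup>+x\<in>F. w x \<partial>lborel)"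
proof -
  have [measurable]: "F \<in> sets borel" "halo e j F \<in> sets borel" using F sets_halo by auto
  note w[measurable]
  have "(\<integral>\<^sup>+x\<in>halo e j F. w x \<partial>lborel) =
     (\<integral>\<^sup>+y. (\<integral>\<^sup>+t\<in>line_halo e {t. upd (vec_lambda y) j t \<in> F}. w (upd (vec_lambda y) j t) \<partial>lborel)
       \<partial>Pi\<^sub>M (UNIV - {j}) (\<lambda>_. lborel))"
  proof -
    have "(\<lambda>x. w x * indicator (halo e j F) x) \<in> borel_measurable borel" by measurable
    from nn_integral_lborel_line[OF this, of j] show ?thesis by (simp add: halo_def indicator_def)
  qed
  also have "\<dots> \<le> (\<integral>\<^sup>+y. (\<integral>\<^sup>+t. ennreal (1 + 4 * r) * (w (upd (vec_lambda y) j t) * indicator F (upd (vec_lambda y) j t)) \<partial>lborel)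
       \<partial>Pi\<^sub>M (UNIV - {j}) (\<lambda>_. lborel))"
  proof (rule nn_integral_mono_AE, use good in \<open>rule eventually_mono\<close>)
    fix y
    let ?v = "\<lambda>t. w (upd (vec_lambda y) j t)" and ?G = "{t. upd (vec_lambda y) j t \<in> F}"
    assume g: "halving \<eta> ?v \<and> (\<forall>a b. (\<integral>\<^sup>+t\<in>{a<..<b}. ?v t \<partial>lborel) < \<infinity>)"
    have v: "?v \<in> borel_measurable borel" by measurable
    have "(\<integral>\<^sup>+t\<in>line_halo e ?G. ?v t \<partial>lborel) \<le> ennreal (1 + 4 * r) * (\<integral>\<^sup>+t\<in>?G. ?v t \<partial>lborel)"
      using line_halo_measure_le[OF v _ _ eta vimage_upd_borel[OF F] e r_def r] g by blast
    also have "(\<integral>\<^sup>+t\<in>?G. ?v t \<partial>lborel) = (\<integral>\<^sup>+t. ?v t * indicator F (upd (vec_lambda y) j t) \<partial>lborel)"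
      by (intro nn_integral_cong) (auto simp: indicator_def)
    also have "ennreal (1 + 4 * r) * \<dots> = (\<integral>\<^sup>+t. ennreal (1 + 4 * r) * (?v t * indicator F (upd (vec_lambda y) j t)) \<partial>lborel)"
      by (rule nn_integral_cmult[symmetric]) measurable
    finally show "(\<integral>\<^sup>+t\<in>line_halo e ?G. ?v t \<partial>lborel)
        \<le> (\<integral>\<^sup>+t. ennreal (1 + 4 * r) * (?v t * indicator F (upd (vec_lambda y) j t)) \<partial>lborel)" .
  qed
  also have "\<dots> = (\<integral>\<^sup>+x. ennreal (1 + 4 * r) * (w x * indicator F x) \<partial>lborel)"
    by (rule nn_integral_lborel_line[symmetric]) measurable
  also have "\<dots> = ennreal (1 + 4 * r) * (\<integral>\<^sup>+x\<in>F. w x \<partial>lborel)" by (rule nn_integral_cmult) measurable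
  finally show ?thesis .
qed

lemma iter_halo_measure_le:
  fixes w :: "real^'n \<Rightarrow> ennreal"
  assumes w: "w \<in> borel_measurable borel"
    and good: "\<And>j. AE y in Pi\<^sub>M (UNIV - {j}) (\<lambda>_. lborel). halving \<eta> (\<lambda>t. w (upd (vec_lambda y) j t)) \<and>
        (\<forall>a b. (\<integral>\<^sup>+t\<in>{a<..<b}. w (upd (vec_lambda y) j t) \<partial>lborel) < \<infinity>)"
    and eta: "0 < \<eta>" "\<eta> \<le> 1" and F: "F \<in> sets borel" and e: "0 < e" "e \<le> 1"
    and r_def: "r = 2 * e powr (ln (1/2) / ln (\<eta>/2))" and r: "r \<le> 1/2"
  shows "(\<integral>\<^sup>+x\<in>iter_halo e js F. w x \<partial>lborel) \<le> ennreal ((1 + 4 * r) ^ length js) * (\<integral>\<^sup>+x\<in>F. w x \<partial>lborel)"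
proof (induction js)
  case (Cons j js)
  have r0: "0 \<le> r" unfolding r_def by simp
  have "(\<integral>\<^sup>+x\<in>iter_halo e (j # js) F. w x \<partial>lborel) \<le> ennreal (1 + 4 * r) * (\<integral>\<^sup>+x\<in>iter_halo e js F. w x \<partial>lborel)"
    using halo_measure_le[OF w good eta sets_iter_halo[OF F] e r_def r] by simp
  also have "\<dots> \<le> ennreal (1 + 4 * r) * (ennreal ((1 + 4 * r) ^ length js) * (\<integral>\<^sup>+x\<in>F. w x \<partial>lborel))"
    using Cons by (rule mult_left_mono) simp
  also have "\<dots> = ennreal ((1 + 4 * r) ^ length (j # js)) * (\<integral>\<^sup>+x\<in>F. w x \<partial>lborel)"
    using r0 by (simp add: ennreal_mult mult.assoc del: ennreal_plus)
  finally show ?case .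
qed simp

text \<open>
  Induction on the coordinates already integrated out. For the last coordinate \<open>j\<close>, let \<open>g t\<close> and \<open>h t\<close> be
  the integrals of \<open>w\<close> over the section at \<open>t\<close> and over its part outside \<open>E\<close>. By Chebyshev, the set of \<open>t\<close>
  with \<open>h t \<ge> s\<^sup>k g t\<close> has \<open>g\<close>-mass at most \<open>s\<close> times the total; \<open>g\<close> is halving, so the set is short,
  and at all other \<open>t\<close>, up to a null set, the induction hypothesis puts the point in the previous halo.
\<close>
lemma mem_iter_haloI:
  fixes w :: "real^'n \<Rightarrow> ennreal" and a b :: "real^'n"
  assumes w: "w \<in> borel_measurable borel" and E: "E \<in> sets borel"
    and ab: "\<And>j. a $ j < b $ j" and eta: "0 < \<eta>" "\<eta> < 1" and s: "0 < s" "s \<le> 1"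
    and e: "1 / (1 - \<eta>) * s powr (ln (1 - \<eta>) / ln (1/8)) < e"
  defines "S \<equiv> \<lambda>j. {a $ j<..<b $ j}"
  shows "distinct js \<Longrightarrow> iter_ae js (\<lambda>y. \<forall>j. halving \<eta> (\<lambda>t. w (upd y j t))) x \<Longrightarrow>
    (\<And>j. j \<in> set js \<Longrightarrow> a $ j \<le> x $ j \<and> x $ j \<le> b $ j) \<Longrightarrow>
    iter_int S js (\<lambda>y. w y * indicator (- E) y) x < ennreal (s ^ length js) * iter_int S js w x \<Longrightarrow>
    iter_int S js w x < \<infinity> \<Longrightarrow> x \<in> iter_halo e js E"
proof (induction js arbitrary: x)
  case Nil
  then have "w x * indicator (- E) x < w x" by simp
  then have "x \<in> E" by (cases "x \<in> E") auto
  then show ?case by simp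
next
  case (Cons j js)
  let ?G = "\<lambda>y. \<forall>j. halving \<eta> (\<lambda>t. w (upd y j t))"
  let ?W = "iter_int S js w" and ?V = "iter_int S js (\<lambda>y. w y * indicator (- E) y)"
  define g where "g t = ?W (upd x j t)" for t
  define h where "h t = ?V (upd x j t)" for t
  let ?k = "length js"
  have dj: "j \<notin> set js" "distinct js" using Cons.prems(1) by auto
  have Sb: "S i \<in> sets borel" for i by (simp add: S_def)
  note w[measurable] E[measurable]
  have [measurable]: "?W \<in> borel_measurable borel" "?V \<in> borel_measurable borel"
    by (auto intro!: borel_measurable_iter_int Sb)
  have [measurable]: "g \<in> borel_measurable borel" "h \<in> borel_measurable borel"
    unfolding g_def h_def by measurable
  let ?I = "{a $ j<..<b $ j}"
  have Wx: "iter_int S (j # js) w x = (\<integral>\<^sup>+t\<in>?I. g t \<partial>lborel)"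
    and Vx: "iter_int S (j # js) (\<lambda>y. w y * indicator (- E) y) x = (\<integral>\<^sup>+t\<in>?I. h t \<partial>lborel)"
    by (simp_all add: g_def h_def S_def)
  have less: "(\<integral>\<^sup>+t\<in>?I. h t \<partial>lborel) < ennreal (s ^ Suc ?k) * (\<integral>\<^sup>+t\<in>?I. g t \<partial>lborel)"
    using Cons.prems(4) unfolding Wx Vx by simp
  have fin: "(\<integral>\<^sup>+t\<in>?I. g t \<partial>lborel) < \<infinity>" using Cons.prems(5) unfolding Wx .
  have pos: "0 < (\<integral>\<^sup>+t\<in>?I. g t \<partial>lborel)"
    using less by (metis mult_zero_right not_less_zero zero_less_iff_neq_zero)
  have ae: "AE t in lborel. iter_ae js ?G (upd x j t)" using Cons.prems(2) by simp
  \<comment> \<open>The lines in direction \<open>j\<close> do not depend on the \<open>j\<close>-th coordinate, so a single good value of it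
    shows that \<open>g\<close> is halving.\<close>
  have "\<exists>t. iter_ae js ?G (upd x j t)"
  proof (rule ccontr)
    assume "\<not> ?thesis"
    then have "AE t in (lborel :: real measure). False" using ae by (auto elim: eventually_mono)
    then show False by (simp add: ae_filter_eq_bot_iff)
  qed
  then obtain t0 where "iter_ae js ?G (upd x j t0)" ..
  then have "iter_ae js (\<lambda>y. halving \<eta> (\<lambda>t. w (upd y j t))) (upd x j t0)"
    by (rule iter_ae_mono) blast
  then have half: "halving \<eta> g"
    using iter_int_halving[OF w Sb dj(1), of \<eta> "upd x j t0"] by (simp add: g_def[abs_def])
  define bad where "bad = {t \<in> ?I. ennreal (s ^ ?k) * g t \<le> h t}"
  have bad[measurable]: "bad \<in> sets borel" "bad \<subseteq> ?I" unfolding bad_def by auto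
  have "ennreal (s ^ ?k) * (\<integral>\<^sup>+t\<in>bad. g t \<partial>lborel) = (\<integral>\<^sup>+t. ennreal (s ^ ?k) * (g t * indicator bad t) \<partial>lborel)"
    by (rule nn_integral_cmult[symmetric]) measurable
  also have "\<dots> \<le> (\<integral>\<^sup>+t\<in>?I. h t \<partial>lborel)"
    by (intro nn_integral_mono) (auto simp: bad_def indicator_def)
  also have "\<dots> \<le> ennreal (s ^ ?k) * (ennreal s * (\<integral>\<^sup>+t\<in>?I. g t \<partial>lborel))"
    using less s by (simp add: ennreal_mult mult_ac)
  finally have "(\<integral>\<^sup>+t\<in>bad. g t \<partial>lborel) \<le> ennreal s * (\<integral>\<^sup>+t\<in>?I. g t \<partial>lborel)"
    using s by (subst (asm) ennreal_mult_le_mult_iff) auto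
  then have "emeasure lborel bad \<le> ennreal (1 / (1 - \<eta>) * s powr (ln (1 - \<eta>) / ln (1/8)) * (b $ j - a $ j))"
    by (intro halving_reverse_power_law[OF _ fin half eta ab pos bad s]) simp
  also have "\<dots> < ennreal (e * (b $ j - a $ j))"
    using e ab[of j] eta by (intro ennreal_lessI mult_strict_right_mono mult_pos_pos) (auto intro: le_less_trans[rotated])
  finally have badlt: "emeasure lborel bad < ennreal (e * (b $ j - a $ j))" .
  let ?H = "iter_halo e js E"
  have H: "?H \<in> sets borel" by (rule sets_iter_halo[OF E])
  have aefin: "AE t in lborel. g t * indicator ?I t \<noteq> \<infinity>"
    using fin by (intro nn_integral_PInf_AE) auto
  have "AE t in lborel. t \<in> ?I - {t. upd x j t \<in> ?H} \<longrightarrow> t \<in> bad"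
    using ae aefin
  proof eventually_elim
    case (elim t)
    show ?case
    proof (intro impI, rule ccontr)
      assume t: "t \<in> ?I - {t. upd x j t \<in> ?H}" "t \<notin> bad"
      have "upd x j t \<in> ?H"
      proof (rule Cons.IH[OF dj(2) elim(1)])
        fix i assume "i \<in> set js"
        then show "a $ i \<le> upd x j t $ i \<and> upd x j t $ i \<le> b $ i"
          using dj(1) Cons.prems(3)[of i] by auto
      next
        show "?V (upd x j t) < ennreal (s ^ ?k) * ?W (upd x j t)"
          using t by (auto simp: bad_def g_def h_def not_le)
        show "?W (upd x j t) < \<infinity>" using elim(2) t by (simp add: g_def less_top)
      qed
      then show False using t by simp
    qed
  qed
  then have "emeasure lborel (?I - {t. upd x j t \<in> ?H}) \<le> emeasure lborel bad"
    using bad by (intro emeasure_mono_AE) auto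
  also note badlt
  finally have "x \<in> halo e j ?H"
    using Cons.prems(3)[of j] by (intro mem_haloI[OF H ab]) auto
  then show ?case by simp
qed

section \<open>Strong Muckenhoupt weights\<close>

lemma maximal1_cong_AE:
  assumes "AE t in lborel. f t = g t"
  shows "maximal1 f = maximal1 g"
proof -
  have "(\<integral>\<^sup>+t\<in>{a..b}. ennreal \<bar>f t\<bar> \<partial>lebesgue) = (\<integral>\<^sup>+t\<in>{a..b}. ennreal \<bar>g t\<bar> \<partial>lebesgue)" for a b
    unfolding nn_integral_completion using assms by (intro nn_integral_cong_AE) (auto elim: eventually_mono)
  then show ?thesis by (simp add: maximal1_def fun_eq_iff)
qed

lemma fujii_wilson_const_cong_AE:
  assumes "AE t in lborel. f t = g t"
  shows "fujii_wilson_const f = fujii_wilson_const g"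
proof -
  have "maximal1 (\<lambda>t. f t * indicator {a..b} t) = maximal1 (\<lambda>t. g t * indicator {a..b} t)" for a b
    using assms by (intro maximal1_cong_AE) (auto elim: eventually_mono)
  moreover have "wmeasure f {a..b} = wmeasure g {a..b}" for a b
    unfolding wmeasure_def nn_integral_completion
    using assms by (intro nn_integral_cong_AE) (auto elim: eventually_mono)
  ultimately show ?thesis by (simp add: fujii_wilson_const_def)
qed

text \<open>
  Sections of a Lebesgue measurable function need not be measurable; those of a Borel representative
  are, on every line.
\<close>
lemma weight_borel_version:
  fixes w :: "real^'n \<Rightarrow> real"
  assumes "weight w"
  obtains u where "u \<in> borel_measurable borel" "\<And>x. 0 \<le> u x" "AE x in lborel. w x = u x"
proof -
  have nonneg: "0 \<le> w x" for x using assms by (simp add: weight_def)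
  have int: "w absolutely_integrable_on cball 0 (real n)" for n using assms by (simp add: weight_def)
  have "w \<in> borel_measurable lebesgue"
  proof (rule borel_measurable_LIMSEQ_real)
    show "(\<lambda>x. indicator (cball 0 (real n)) x *\<^sub>R w x) \<in> borel_measurable lebesgue" for n
      using int[of n] unfolding set_integrable_def by (rule borel_measurable_integrable)
    fix x :: "real^'n"
    obtain N where N: "norm x \<le> real N" using real_arch_simple by blast
    have "\<forall>\<^sub>F n in sequentially. indicator (cball 0 (real n)) x *\<^sub>R w x = w x"
      using eventually_ge_at_top[of N] by eventually_elim (use N in auto)
    then show "(\<lambda>n. indicator (cball 0 (real n)) x *\<^sub>R w x) \<longlonglongrightarrow> w x" by (rule tendsto_eventually)
  qed
  then obtain g where g: "g \<in> borel_measurable lborel" "AE x in lborel. w x = g x"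
    using completion_ex_borel_measurable_real by blast
  show thesis
  proof
    show "(\<lambda>x. max 0 (g x)) \<in> borel_measurable borel" using g(1) by simp
    show "AE x in lborel. w x = max 0 (g x)"
      using g(2)
    proof eventually_elim
      case (elim x)
      then show ?case using nonneg[of x] by simp
    qed
  qed simp
qed

lemma weight_finite_on_compact:
  assumes "weight w" "compact K"
  shows "wmeasure w K < \<infinity>"
proof -
  have "set_integrable lebesgue K w" using assms by (simp add: weight_def)
  then have "(\<integral>\<^sup>+x. ennreal (norm (indicator K x *\<^sub>R w x)) \<partial>lebesgue) < \<infinity>"
    unfolding set_integrable_def integrable_iff_bounded by blast
  also have "(\<integral>\<^sup>+x. ennreal (norm (indicator K x *\<^sub>R w x)) \<partial>lebesgue) = wmeasure w K"
    unfolding wmeasure_def using assms(1) by (intro nn_integral_cong) (auto simp: indicator_def weight_def)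
  finally show ?thesis .
qed

lemma wmeasure_cong_AE:
  assumes "AE x in lborel. w x = u x"
  shows "wmeasure w E = (\<integral>\<^sup>+x\<in>E. ennreal (u x) \<partial>lborel)"
  unfolding wmeasure_def nn_integral_completion
  using assms by (intro nn_integral_cong_AE) (auto elim: eventually_mono)

lemma AE_lines_locally_finite:
  fixes f :: "real^'n \<Rightarrow> ennreal"
  assumes f[measurable]: "f \<in> borel_measurable borel" and fin: "\<And>a b. (\<integral>\<^sup>+x\<in>cbox a b. f x \<partial>lborel) < \<infinity>"
  shows "AE y in Pi\<^sub>M (UNIV - {j}) (\<lambda>_. lborel). \<forall>a b. (\<integral>\<^sup>+t\<in>{a<..<b}. f (upd (vec_lambda y) j t) \<partial>lborel) < \<infinity>"
proof -
  let ?P = "Pi\<^sub>M (UNIV - {j}) (\<lambda>_::'n. lborel :: real measure)"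
  define B where "B n = cbox (\<chi> i. - real n) ((\<chi> i. real n) :: real^'n)" for n
  let ?g = "\<lambda>n y. \<integral>\<^sup>+t. f (upd (vec_lambda y) j t) * indicator (B n) (upd (vec_lambda y) j t) \<partial>lborel"
  have [measurable]: "B n \<in> sets borel" for n by (simp add: B_def)
  have "AE y in ?P. ?g n y \<noteq> \<infinity>" for n
  proof (rule nn_integral_PInf_AE)
    have "(\<lambda>p. f (upd (vec_lambda (fst p)) j (snd p)) * indicator (B n) (upd (vec_lambda (fst p)) j (snd p)))
        \<in> borel_measurable (?P \<Otimes>\<^sub>M borel)"
      using measurable_compose[OF measurable_upd_vec_lambda, of "\<lambda>x. f x * indicator (B n) x"]
      by (simp add: case_prod_beta')
    then have "(\<lambda>(y, t). f (upd (vec_lambda y) j t) * indicator (B n) (upd (vec_lambda y) j t)) \<in> borel_measurable (?P \<Otimes>\<^sub>M lborel)"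
      by (simp add: case_prod_beta' cong: measurable_cong_sets)
    then show "?g n \<in> borel_measurable ?P" using lborel.borel_measurable_nn_integral by simp
    have "(\<integral>\<^sup>+y. ?g n y \<partial>?P) = (\<integral>\<^sup>+x\<in>B n. f x \<partial>lborel)"
      by (rule nn_integral_lborel_line[symmetric]) measurable
    then show "(\<integral>\<^sup>+y. ?g n y \<partial>?P) \<noteq> \<infinity>" using fin by (simp add: B_def less_top)
  qed
  then have "AE y in ?P. \<forall>n. ?g n y \<noteq> \<infinity>" by (simp add: AE_all_countable)
  then show ?thesis
  proof (rule eventually_mono, intro allI)
    fix y :: "'n \<Rightarrow> real" and a b :: real
    assume fin: "\<forall>n. ?g n y \<noteq> \<infinity>"
    obtain n where n: "Max (insert \<bar>a\<bar> (insert \<bar>b\<bar> (range (\<lambda>i. \<bar>y i\<bar>)))) \<le> real n" using real_arch_simple by blast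
    then have n': "\<bar>a\<bar> \<le> real n" "\<bar>b\<bar> \<le> real n" "\<And>i. \<bar>y i\<bar> \<le> real n" by auto
    have "(\<integral>\<^sup>+t\<in>{a<..<b}. f (upd (vec_lambda y) j t) \<partial>lborel) \<le> ?g n y"
    proof (intro nn_integral_mono)
      fix t
      have "upd (vec_lambda y) j t \<in> B n" if "t \<in> {a<..<b}"
      proof -
        have "- real n \<le> y i \<and> y i \<le> real n" for i using n'(3)[of i] by linarith
        then show ?thesis using that n' by (auto simp: B_def mem_box_cart)
      qed
      then show "f (upd (vec_lambda y) j t) * indicator {a<..<b} t
          \<le> f (upd (vec_lambda y) j t) * indicator (B n) (upd (vec_lambda y) j t)"
        by (auto simp: indicator_def)
    qed
    then show "(\<integral>\<^sup>+t\<in>{a<..<b}. f (upd (vec_lambda y) j t) \<partial>lborel) < \<infinity>"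
      using fin by (metis infinity_ennreal_def less_top order_le_less_trans)
  qed
qed

text \<open>
  Almost every slice of \<open>w\<close> agrees almost everywhere with the slice of its Borel version \<open>u\<close>, so it has the same
  Fujii--Wilson constant. Local integrability of the slices comes separately from Fubini, since
  averages over intervals of infinite mass are zero and leave the constant unaffected.
\<close>
lemma strong_muckenhoupt_slices:
  fixes w :: "real^'n \<Rightarrow> real"
  assumes w: "strong_muckenhoupt w" and u: "u \<in> borel_measurable borel" "\<And>x. 0 \<le> u x"
    and wu: "AE x in lborel. w x = u x"
  obtains \<eta> :: real where "0 < \<eta>" "\<eta> < 1"
    "\<And>j. AE y in Pi\<^sub>M (UNIV - {j}) (\<lambda>_. lborel). halving \<eta> (\<lambda>t. ennreal (u (upd (vec_lambda y) j t))) \<and>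
        (\<forall>a b. (\<integral>\<^sup>+t\<in>{a<..<b}. ennreal (u (upd (vec_lambda y) j t)) \<partial>lborel) < \<infinity>)"
proof -
  have weight: "weight w" and fin: "strong_A_infinity_const w < \<infinity>"
    using w by (simp_all add: strong_muckenhoupt_def)
  obtain c where c: "strong_A_infinity_const w < c" "c < \<infinity>" using fin dense by blast
  then obtain A where A: "c = ennreal A" "0 \<le> A" by (cases c) auto
  define \<eta> :: real where "\<eta> = (1/2) ^ (nat \<lceil>4 * A\<rceil> + 3)"
  have eta: "0 < \<eta>" "\<eta> < 1" unfolding \<eta>_def by (auto simp: power_less_one_iff simp del: power_add)
  show thesis
  proof (rule that[OF eta])
    fix j :: 'n
    let ?P = "Pi\<^sub>M (UNIV - {j}) (\<lambda>_::'n. lborel :: real measure)"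
    have "ess_sup ?P (\<lambda>y. fujii_wilson_const (slice w j y)) < c"
      using c(1) unfolding strong_A_infinity_const_def by (rule le_less_trans[OF SUP_upper[OF UNIV_I]])
    then obtain c' where c': "AE y in ?P. fujii_wilson_const (slice w j y) \<le> c'" "c' < c"
      unfolding ess_sup_def by (auto simp: Inf_less_iff)
    have sl: "slice w j y t = w (upd (vec_lambda y) j t)" for y t
    proof -
      have "(\<chi> i. if i = j then t else y i) = upd (vec_lambda y) j t" by (simp add: vec_eq_iff)
      then show ?thesis by (simp add: slice_def)
    qed
    have lf: "AE y in ?P. \<forall>a b. (\<integral>\<^sup>+t\<in>{a<..<b}. ennreal (u (upd (vec_lambda y) j t)) \<partial>lborel) < \<infinity>"
    proof (rule AE_lines_locally_finite)
      show "(\<integral>\<^sup>+x\<in>cbox a b. ennreal (u x) \<partial>lborel) < \<infinity>" for a b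
        using weight_finite_on_compact[OF weight compact_cbox[of a b]] wmeasure_cong_AE[OF wu] by simp
    qed (use u in simp)
    show "AE y in ?P. halving \<eta> (\<lambda>t. ennreal (u (upd (vec_lambda y) j t))) \<and>
        (\<forall>a b. (\<integral>\<^sup>+t\<in>{a<..<b}. ennreal (u (upd (vec_lambda y) j t)) \<partial>lborel) < \<infinity>)"
      using c'(1) lf AE_lines_if_AE_lborel[OF wu, of j]
    proof eventually_elim
      case (elim y)
      have "fujii_wilson_const (\<lambda>t. u (upd (vec_lambda y) j t)) = fujii_wilson_const (slice w j y)"
        by (intro fujii_wilson_const_cong_AE) (use elim(3) in \<open>auto simp: sl elim: eventually_mono\<close>)
      also have "\<dots> \<le> ennreal A" using elim(1) c'(2) A by simp
      finally have "halving \<eta> (\<lambda>t. ennreal (u (upd (vec_lambda y) j t)))"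
        unfolding \<eta>_def using elim(2) A(2) u
        by (intro fujii_wilson_halving) (auto intro!: measurable_compose[OF measurable_upd])
      then show ?case using elim(2) by blast
    qed
  qed
qed

lemma set_nn_integral_cbox_eq_box:
  fixes f :: "'a::euclidean_space \<Rightarrow> ennreal"
  shows "(\<integral>\<^sup>+x\<in>cbox a b. f x \<partial>lborel) = (\<integral>\<^sup>+x\<in>box a b. f x \<partial>lborel)"
proof (rule nn_integral_cong_AE)
  have "cbox a b - box a b \<in> null_sets lebesgue"
    using negligible_frontier_interval by (simp add: negligible_iff_null_sets)
  then have "cbox a b - box a b \<in> null_sets lborel" by (subst (asm) null_sets_completion_iff) auto
  then have "AE x in lborel. x \<notin> cbox a b - box a b" by (rule AE_not_in)
  then show "AE x in lborel. f x * indicator (cbox a b) x = f x * indicator (box a b) x"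
    by eventually_elim (use box_subset_cbox[of a b] in \<open>auto simp: indicator_def\<close>)
qed

lemma prod_indicator_box:
  fixes a b :: "real^'n"
  shows "(\<Prod>i\<in>UNIV. indicator {a $ i<..<b $ i} (x $ i)) = (indicator (box a b) x :: ennreal)"
proof (cases "x \<in> box a b")
  case True then show ?thesis by (auto simp: mem_box_cart)
next
  case False
  then obtain i where "x $ i \<notin> {a $ i<..<b $ i}" by (auto simp: mem_box_cart)
  then have "\<exists>i\<in>UNIV. indicator {a $ i<..<b $ i} (x $ i) = (0::ennreal)" by (intro bexI[of _ i]) auto
  then show ?thesis using False by (simp add: prod_zero)
qed

text \<open>
  The rectangles admitted by the maximal function are exactly those to which the iterated halo applies:
  an average above \<open>\<alpha> = 1 - s\<^sup>n\<close> says that \<open>E\<close> misses less than the fraction \<open>s\<^sup>n\<close> of the mass. Replacing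
  \<open>E\<close> by a Borel set of full measure in it changes no average.
\<close>
lemma tauberian_const_le:
  fixes w :: "real^'n \<Rightarrow> real"
  assumes weight: "weight w" and u: "u \<in> borel_measurable borel" "\<And>x. 0 \<le> u x"
    and wu: "AE x in lborel. w x = u x"
    and eta: "0 < \<eta>" "\<eta> < 1"
    and good: "\<And>j. AE y in Pi\<^sub>M (UNIV - {j}) (\<lambda>_. lborel). halving \<eta> (\<lambda>t. ennreal (u (upd (vec_lambda y) j t))) \<and>
        (\<forall>a b. (\<integral>\<^sup>+t\<in>{a<..<b}. ennreal (u (upd (vec_lambda y) j t)) \<partial>lborel) < \<infinity>)"
    and \<alpha>: "0 < \<alpha>" "\<alpha> < 1" and s: "0 < s" "s ^ CARD('n) = 1 - \<alpha>"
    and e: "1 / (1 - \<eta>) * s powr (ln (1 - \<eta>) / ln (1/8)) < e" "e \<le> 1"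
    and r_def: "r = 2 * e powr (ln (1/2) / ln (\<eta>/2))" and r: "r \<le> 1/2"
  shows "tauberian_const w \<alpha> \<le> ennreal ((1 + 4 * r) ^ CARD('n))"
  unfolding tauberian_const_def
proof (rule SUP_least)
  fix E assume "E \<in> {E \<in> sets lebesgue. 0 < wmeasure w E \<and> wmeasure w E < \<infinity>}"
  then have E: "E \<in> sets lebesgue" "0 < wmeasure w E" "wmeasure w E < \<infinity>" by auto
  have wm: "wmeasure w X = (\<integral>\<^sup>+x\<in>X. ennreal (u x) \<partial>lborel)" for X by (rule wmeasure_cong_AE[OF wu])
  have s1: "s \<le> 1"
  proof (rule ccontr)
    assume "\<not> s \<le> 1"
    then have "1 \<le> s ^ CARD('n)" by (intro one_le_power) simp
    then show False using s(2) \<alpha> by simp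
  qed
  have e0: "0 < e" using e(1) eta s(1) by (auto intro: le_less_trans[rotated])
  obtain F N N' where F: "E = F \<union> N" "N \<subseteq> N'" "N' \<in> null_sets lborel" "F \<in> sets lborel"
    using E(1) by (rule sets_completionE)
  have Fb: "F \<in> sets borel" using F(4) by simp
  have EF: "AE x in lborel. x \<in> E \<longleftrightarrow> x \<in> F"
    using AE_not_in[OF F(3)] by eventually_elim (use F in auto)
  obtain js :: "'n list" where js: "set js = UNIV" "distinct js" using finite_distinct_list[of "UNIV :: 'n set"] by auto
  have len: "length js = CARD('n)" using distinct_card[OF js(2)] js(1) by simp
  let ?u = "\<lambda>x. ennreal (u x)"
  have um: "?u \<in> borel_measurable borel" using u by simp
  have "AE x in lborel. halving \<eta> (\<lambda>t. ?u (upd x j t))" for j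
    by (rule AE_lborel_if_AE_lines[where Q = "\<lambda>v. halving \<eta> (\<lambda>t. ?u (v t))"])
      (use good[of j] in \<open>auto elim: eventually_mono\<close>)
  then have "AE x in lborel. \<forall>j. halving \<eta> (\<lambda>t. ?u (upd x j t))" by (intro eventually_all_finite) auto
  then have good': "iter_ae js (\<lambda>x. \<forall>j. halving \<eta> (\<lambda>t. ?u (upd x j t))) x" for x
    by (rule iter_ae_full) (use js in auto)
  have sub: "{x. ennreal \<alpha> < strong_maximal w (indicator E) x} \<subseteq> iter_halo e js F"
  proof
    fix x assume "x \<in> {x. ennreal \<alpha> < strong_maximal w (indicator E) x}"
    then obtain a b where ab: "box a b \<noteq> {}" "x \<in> cbox a b"
      and gt: "ennreal \<alpha> < (\<integral>\<^sup>+y\<in>cbox a b. ennreal (\<bar>indicator E y\<bar> * w y) \<partial>lebesgue) / wmeasure w (cbox a b)"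
      unfolding strong_maximal_def by (auto simp: less_SUP_iff)
    have lt: "a $ j < b $ j" for j using ab(1) by (metis interval_ne_empty_cart(2))
    let ?S = "\<lambda>j. {a $ j<..<b $ j}"
    have "(\<integral>\<^sup>+y\<in>cbox a b. ennreal (\<bar>indicator E y\<bar> * w y) \<partial>lebesgue) = (\<integral>\<^sup>+y\<in>cbox a b. ?u y * indicator F y \<partial>lborel)"
      unfolding nn_integral_completion
    proof (rule nn_integral_cong_AE)
      show "AE y in lborel. ennreal (\<bar>indicator E y\<bar> * w y) * indicator (cbox a b) y = ?u y * indicator F y * indicator (cbox a b) y"
        using EF wu by eventually_elim (auto simp: indicator_def)
    qed
    then have num: "(\<integral>\<^sup>+y\<in>cbox a b. ennreal (\<bar>indicator E y\<bar> * w y) \<partial>lebesgue) = (\<integral>\<^sup>+y\<in>box a b. ?u y * indicator F y \<partial>lborel)"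
      by (simp add: set_nn_integral_cbox_eq_box)
    have den: "wmeasure w (cbox a b) = (\<integral>\<^sup>+y\<in>box a b. ?u y \<partial>lborel)"
      by (simp add: wm set_nn_integral_cbox_eq_box)
    have full: "iter_int ?S js f x = (\<integral>\<^sup>+y\<in>box a b. f y \<partial>lborel)" if "f \<in> borel_measurable borel" for f
      using iter_int_full[OF that _ js(2,1), of ?S] by (simp add: prod_indicator_box)
    let ?D = "\<integral>\<^sup>+y\<in>box a b. ?u y \<partial>lborel" and ?A = "\<integral>\<^sup>+y\<in>box a b. ?u y * indicator F y \<partial>lborel"
      and ?V = "\<integral>\<^sup>+y\<in>box a b. ?u y * indicator (- F) y \<partial>lborel"
    have split: "?D = ?A + ?V"
    proof -
      have "?D = (\<integral>\<^sup>+y. ?u y * indicator F y * indicator (box a b) y + ?u y * indicator (- F) y * indicator (box a b) y \<partial>lborel)"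
        by (intro nn_integral_cong) (auto simp: indicator_def)
      also have "\<dots> = ?A + ?V" using um Fb by (intro nn_integral_add) auto
      finally show ?thesis .
    qed
    have Dfin: "?D < \<infinity>" using weight_finite_on_compact[OF weight compact_cbox[of a b]] den by simp
    obtain A V where AV: "?A = ennreal A" "?V = ennreal V" "0 \<le> A" "0 \<le> V"
      using Dfin split by (cases ?A; cases ?V) auto
    have D: "?D = ennreal (A + V)" using split AV by simp
    have gt': "ennreal \<alpha> < ennreal A / ennreal (A + V)" using gt unfolding num den D AV(1) .
    have pos: "0 < A + V"
    proof (rule ccontr)
      assume "\<not> 0 < A + V"
      then have "A = 0" "V = 0" using AV by auto
      then show False using gt' by simp
    qed
    have "\<alpha> < A / (A + V)" using gt' AV pos \<alpha> by (simp add: divide_ennreal ennreal_less_iff del: ennreal_plus)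
    then have "\<alpha> * (A + V) < A" using pos by (simp add: pos_less_divide_eq)
    then have "V < (1 - \<alpha>) * (A + V)" by (simp add: algebra_simps)
    then have V: "?V < ennreal (s ^ length js) * ?D"
      unfolding AV(2) D len s(2) using AV pos \<alpha> by (simp add: ennreal_mult[symmetric] ennreal_less_iff del: ennreal_plus)
    show "x \<in> iter_halo e js F"
    proof (rule mem_iter_haloI[OF um Fb lt eta s(1) s1 e(1) js(2) good'])
      show "a $ j \<le> x $ j \<and> x $ j \<le> b $ j" for j using ab(2) by (simp add: mem_box_cart)
      have "(\<lambda>y. ?u y * indicator (- F) y) \<in> borel_measurable borel" using um Fb by simp
      then show "iter_int ?S js (\<lambda>y. ?u y * indicator (- F) y) x < ennreal (s ^ length js) * iter_int ?S js ?u x"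
        using V by (simp only: full um)
      show "iter_int ?S js ?u x < \<infinity>" using Dfin by (simp only: full um)
    qed
  qed
  have "wmeasure w {x. ennreal \<alpha> < strong_maximal w (indicator E) x} \<le> (\<integral>\<^sup>+x\<in>iter_halo e js F. ?u x \<partial>lborel)"
    unfolding wm using sub by (intro nn_integral_mono) (auto simp: indicator_def)
  also have "\<dots> \<le> ennreal ((1 + 4 * r) ^ length js) * (\<integral>\<^sup>+x\<in>F. ?u x \<partial>lborel)"
    by (rule iter_halo_measure_le[OF um good eta(1) less_imp_le[OF eta(2)] Fb e0 e(2) r_def r])
  also have "(\<integral>\<^sup>+x\<in>F. ?u x \<partial>lborel) = wmeasure w E"
    unfolding wm using EF by (intro nn_integral_cong_AE) (auto elim!: eventually_mono simp: indicator_def)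
  finally have "wmeasure w {x. ennreal \<alpha> < strong_maximal w (indicator E) x} / wmeasure w E
      \<le> ennreal ((1 + 4 * r) ^ CARD('n)) * wmeasure w E / wmeasure w E"
    unfolding len by (rule divide_right_mono_ennreal)
  also have "\<dots> = ennreal ((1 + 4 * r) ^ CARD('n))"
    using E by (intro ennreal_mult_divide_eq) auto
  finally show "wmeasure w {x. ennreal \<alpha> < strong_maximal w (indicator E) x} / wmeasure w E \<le> ennreal ((1 + 4 * r) ^ CARD('n))" .
qed

text \<open>
  The chord of a convex function over the unit interval.
\<close>
lemma one_plus_power_le:
  fixes y :: real
  assumes "0 \<le> y" "y \<le> 1"
  shows "(1 + y) ^ n \<le> 1 + (2 ^ n - 1) * y"
proof (induction n)
  case (Suc n)
  have "(1 + y) ^ Suc n \<le> (1 + y) * (1 + (2 ^ n - 1) * y)" using Suc assms by (simp add: mult_left_mono)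
  also have "\<dots> = 1 + 2 ^ n * y + (2 ^ n - 1) * (y * y)" by (simp add: algebra_simps)
  also have "\<dots> \<le> 1 + 2 ^ n * y + (2 ^ n - 1) * y"
    using assms by (intro add_left_mono mult_left_mono) (auto simp: mult_left_le)
  also have "\<dots> = 1 + (2 ^ Suc n - 1) * y" by (simp add: algebra_simps)
  finally show ?case .
qed simp

theorem theorem1p5:
  fixes w :: "real^'n \<Rightarrow> real"
  assumes "strong_muckenhoupt w"
  shows "\<exists>c>0. \<exists>C>0. \<exists>\<alpha>\<^sub>0\<in>{0<..<1}. \<forall>\<alpha>\<in>{\<alpha>\<^sub>0<..<1}.
           tauberian_const w \<alpha> - 1 \<le> ennreal (C * (1 - \<alpha>) powr c)"
proof -
  have weight: "weight w" using assms by (simp add: strong_muckenhoupt_def)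
  obtain u where u: "u \<in> borel_measurable borel" "\<And>x. 0 \<le> u x" and wu: "AE x in lborel. w x = u x"
    using weight_borel_version[OF weight] by blast
  obtain \<eta> :: real where eta: "0 < \<eta>" "\<eta> < 1"
    and good: "\<And>j. AE y in Pi\<^sub>M (UNIV - {j}) (\<lambda>_. lborel). halving \<eta> (\<lambda>t. ennreal (u (upd (vec_lambda y) j t))) \<and>
        (\<forall>a b. (\<integral>\<^sup>+t\<in>{a<..<b}. ennreal (u (upd (vec_lambda y) j t)) \<partial>lborel) < \<infinity>)"
    using strong_muckenhoupt_slices[OF assms u wu] by blast
  let ?n = "CARD('n)"
  define \<beta> where "\<beta> = ln (1 - \<eta>) / ln (1/8)"
  define \<delta> where "\<delta> = ln (1/2) / ln (\<eta>/2)"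
  define D where "D = 2 / (1 - \<eta>)"
  have pos: "0 < \<beta>" "0 < \<delta>" "0 < D" "0 < real ?n"
    using eta by (auto simp: \<beta>_def \<delta>_def D_def intro!: divide_neg_neg)
  \<comment> \<open>For \<open>e \<le> e0\<close> the relative growth \<open>4 * r = 8 * e powr \<delta>\<close> of one halo is at most one.\<close>
  define e0 where "e0 = min 1 ((1/8) powr (1/\<delta>))"
  have e0: "0 < e0" "e0 \<le> 1" "e0 powr \<delta> \<le> 1/8"
  proof -
    show "0 < e0" "e0 \<le> 1" by (auto simp: e0_def)
    have "e0 powr \<delta> \<le> ((1/8) powr (1/\<delta>)) powr \<delta>" using pos by (intro powr_mono2) (auto simp: e0_def)
    then show "e0 powr \<delta> \<le> 1/8" using pos by (simp add: powr_powr)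
  qed
  \<comment> \<open>For \<open>1 - \<alpha> < \<rho>\<close> the admissible fraction \<open>e = D * s powr \<beta>\<close> is at most \<open>e0\<close>.\<close>
  define \<rho> where "\<rho> = min (1/2) ((e0 / D) powr (?n / \<beta>))"
  have rho: "0 < \<rho>" "\<rho> \<le> 1/2" using e0 pos by (auto simp: \<rho>_def)
  define c where "c = \<beta> * \<delta> / ?n"
  define C where "C = 2 ^ ?n * (8 * D powr \<delta>)"
  have "tauberian_const w \<alpha> - 1 \<le> ennreal (C * (1 - \<alpha>) powr c)" if \<alpha>: "\<alpha> \<in> {1 - \<rho><..<1}" for \<alpha>
  proof -
    define s where "s = (1 - \<alpha>) powr (1 / ?n)"
    have a: "0 < \<alpha>" "\<alpha> < 1" "1 - \<alpha> < \<rho>" using \<alpha> rho by auto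
    have s: "0 < s" "s ^ ?n = 1 - \<alpha>"
      using a pos by (auto simp: s_def powr_realpow[symmetric] powr_powr)
    have sb: "s powr \<beta> = (1 - \<alpha>) powr (\<beta> / ?n)" by (simp add: s_def powr_powr)
    \<comment> \<open>Twice the threshold required of \<open>e\<close>, to make the inequality strict.\<close>
    define e where "e = D * s powr \<beta>"
    have e: "1 / (1 - \<eta>) * s powr \<beta> < e" unfolding e_def D_def using s eta by (simp add: divide_strict_right_mono)
    have epos: "0 < e" using s pos by (simp add: e_def)
    have "s powr \<beta> \<le> ((e0 / D) powr (?n / \<beta>)) powr (\<beta> / ?n)"
      unfolding sb using a pos by (intro powr_mono2) (auto simp: \<rho>_def)
    also have "\<dots> = e0 / D" using pos e0 by (simp add: powr_powr)
    finally have ee0: "e \<le> e0" using pos by (simp add: e_def field_simps)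
    define r where "r = 2 * e powr \<delta>"
    have "e powr \<delta> \<le> e0 powr \<delta>" using ee0 epos pos by (intro powr_mono2) auto
    then have r: "0 \<le> r" "r \<le> 1/4" using e0(3) by (auto simp: r_def)
    have "tauberian_const w \<alpha> \<le> ennreal ((1 + 4 * r) ^ ?n)"
      by (rule tauberian_const_le[OF weight u wu eta good a(1,2) s, where e = e])
        (use e ee0 e0 r in \<open>auto simp: r_def \<beta>_def \<delta>_def\<close>)
    also have "\<dots> \<le> ennreal (1 + C * (1 - \<alpha>) powr c)"
    proof (intro ennreal_leI)
      have "(1 + 4 * r) ^ ?n \<le> 1 + (2 ^ ?n - 1) * (4 * r)" using r by (intro one_plus_power_le) auto
      also have "\<dots> \<le> 1 + 2 ^ ?n * (4 * r)" using r by (intro add_left_mono mult_right_mono) auto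
      also have "2 ^ ?n * (4 * r) = C * (1 - \<alpha>) powr c"
        using pos by (simp add: r_def e_def C_def c_def sb powr_mult powr_powr)
      finally show "(1 + 4 * r) ^ ?n \<le> 1 + C * (1 - \<alpha>) powr c" by simp
    qed
    finally have "tauberian_const w \<alpha> - 1 \<le> ennreal (1 + C * (1 - \<alpha>) powr c) - 1"
      by (rule ennreal_minus_mono) simp
    also have "\<dots> = ennreal (C * (1 - \<alpha>) powr c)"
      using pos by (subst ennreal_1[symmetric], subst ennreal_minus) (auto simp: C_def)
    finally show ?thesis .
  qed
  moreover have "0 < c" "0 < C" using pos by (auto simp: c_def C_def)
  moreover have "1 - \<rho> \<in> {0<..<1}" using rho by auto
  ultimately show ?thesis by blast
qed


end
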